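(* There is a constant $C>0$ such that the following holds. Let $u\in\mathcal{D}'(S^1)$ be such that $(-\Delta)^{1/4}u\in \dot H^{-1/2}(S^1)+L^1(S^1)$ and $\mathcal{R}(-\Delta)^{1/4}u\in \dot H^{-1/2}(S^1)+L^1(S^1)$. Then $u-\bar u\in L^2_*(S^1)$, where $\bar u$ denotes the mean of $u$ over $S^1$, and $$\|u-\bar u\|_{L^2(S^1)}\le C\left(\|(-\Delta)^{1/4}u\|_{\dot H^{-1/2}(S^1)+L^1(S^1)}+\|\mathcal{R}(-\Delta)^{1/4}u\|_{\dot H^{-1/2}(S^1)+L^1(S^1)}\right).$$ The constant $C$ is independent of $u$.
   Context: $S^1=\mathbb{R}/2\pi\mathbb{Z}$; $\mathcal{D}'(S^1)$ is the space of (complex-valued) distributions on $S^1$, with Fourier coefficients $\hat u(m)=\frac{1}{2\pi}\langle u,e^{-im\cdot}\rangle$, $m\in\mathbb{Z}$. The mean of $u$ is $\bar u=\hat u(0)$. $L^2_*(S^1)$ is the space of $v\in L^2(S^1)$ with mean zero. $(-\Delta)^{1/4}$ and the Riesz transform $\mathcal{R}$ are the Fourier multiplier operators on $\mathcal{D}'(S^1)$ with multipliers $|m|^{1/2}$ and $i\,\mathrm{sign}(m)$ respectively (with $\mathrm{sign}(0)=0$). $\dot H^{-1/2}(S^1)$ is the space of distributions $f=(-\Delta)^{1/4}g$ with $g\in L^2(S^1)$ (so $\hat f(0)=0$), with norm $\|f\|_{\dot H^{-1/2}}^2=\sum_{m\neq 0}|m|^{-1}|\hat f(m)|^2$. $\dot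 H^{-1/2}(S^1)+L^1(S^1)$ is the space of distributions $v=f+g$ with $f\in\dot H^{-1/2}(S^1)$, $g\in L^1(S^1)$, with norm $\inf\{\|f\|_{\dot H^{-1/2}}+\|g\|_{L^1}: v=f+g\}$. *)

theory Defs
  imports "HOL-Analysis.Analysis"
begin

text \<open>
  Smooth functions on the circle are 2 pi-periodic smooth functions on the line; integrable
  functions on the circle are functions restricted to the fundamental domain [0, 2 pi).
\<close>

abbreviation circle :: "real measure" where
  "circle \<equiv> lebesgue_on {0..<2*pi}"

definition nth_deriv :: "nat \<Rightarrow> (real \<Rightarrow> complex) \<Rightarrow> real \<Rightarrow> complex" where
  "nth_deriv k f = ((\<lambda>g x. vector_derivative g (at x)) ^^ k) f"

definition test_fun :: "(real \<Rightarrow> complex) \<Rightarrow> bool" where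
  "test_fun \<phi> \<longleftrightarrow>
     (\<forall>k x. nth_deriv k \<phi> differentiable (at x)) \<and> (\<forall>x. \<phi> (x + 2*pi) = \<phi> x)"

text \<open>
  A distribution is a complex-linear functional on test functions that is continuous for the
  Frechet topology given by the seminorms sup |nth_deriv k|. The value 0 is prescribed off the
  test functions, so that equality of distributions is equality of functions.
\<close>

definition distribution :: "((real \<Rightarrow> complex) \<Rightarrow> complex) \<Rightarrow> bool" where
  "distribution u \<longleftrightarrow>
     (\<forall>\<phi>. \<not> test_fun \<phi> \<longrightarrow> u \<phi> = 0) \<and>
     (\<forall>\<phi> \<psi> a b. test_fun \<phi> \<longrightarrow> test_fun \<psi> \<longrightarrow>
        u (\<lambda>x. a * \<phi> x + b * \<psi> x) = a * u \<phi> + b * u \<psi>) \<and>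
     (\<exists>(K::real) (N::nat). \<forall>\<phi>. test_fun \<phi> \<longrightarrow>
        cmod (u \<phi>) \<le> K * (\<Sum>k\<le>N. SUP x. cmod (nth_deriv k \<phi> x)))"

definition dist_of :: "(real \<Rightarrow> complex) \<Rightarrow> (real \<Rightarrow> complex) \<Rightarrow> complex" where
  "dist_of g = (\<lambda>\<phi>. if test_fun \<phi> then (LINT x|circle. g x * \<phi> x) else 0)"

definition fourier_coeff :: "((real \<Rightarrow> complex) \<Rightarrow> complex) \<Rightarrow> int \<Rightarrow> complex" where
  "fourier_coeff u m = u (\<lambda>x. cis (- (of_int m * x))) / complex_of_real (2*pi)"

definition dist_mean :: "((real \<Rightarrow> complex) \<Rightarrow> complex) \<Rightarrow> complex" where
  "dist_mean u = fourier_coeff u 0"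

text \<open>
  The distribution with Fourier series \<open>\<Sum>m. a m * fourier_coeff u m * e^(imx)\<close>. For a
  distribution u and polynomially bounded a, the sum below is absolutely convergent, because the
  integrals decay faster than any power of m.
\<close>

definition fourier_multiplier ::
  "(int \<Rightarrow> complex) \<Rightarrow> ((real \<Rightarrow> complex) \<Rightarrow> complex) \<Rightarrow> (real \<Rightarrow> complex) \<Rightarrow> complex" where
  "fourier_multiplier a u = (\<lambda>\<phi>. if test_fun \<phi>
     then (\<Sum>\<^sub>\<infinity>m\<in>UNIV. a m * fourier_coeff u m * (LINT x|circle. cis (of_int m * x) * \<phi> x))
     else 0)"

definition quarter_laplacian ::
  "((real \<Rightarrow> complex) \<Rightarrow> complex) \<Rightarrow> (real \<Rightarrow> complex) \<Rightarrow> complex" where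
  "quarter_laplacian = fourier_multiplier (\<lambda>m. complex_of_real (sqrt \<bar>real_of_int m\<bar>))"

definition riesz_transform ::
  "((real \<Rightarrow> complex) \<Rightarrow> complex) \<Rightarrow> (real \<Rightarrow> complex) \<Rightarrow> complex" where
  "riesz_transform = fourier_multiplier (\<lambda>m. \<i> * of_int (sgn m))"

definition L1 :: "(real \<Rightarrow> complex) set" where
  "L1 = {g. integrable circle g}"

definition L1_norm :: "(real \<Rightarrow> complex) \<Rightarrow> real" where
  "L1_norm g = (LINT x|circle. cmod (g x))"

definition L2 :: "(real \<Rightarrow> complex) set" where
  "L2 = {g. g \<in> borel_measurable circle \<and> integrable circle (\<lambda>x. (cmod (g x))\<^sup>2)}"

definition L2_norm :: "(real \<Rightarrow> complex) \<Rightarrow> real" where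
  "L2_norm g = sqrt (LINT x|circle. (cmod (g x))\<^sup>2)"

definition L2_star :: "(real \<Rightarrow> complex) set" where
  "L2_star = {v \<in> L2. (LINT x|circle. v x) = 0}"

definition H_minus_half :: "((real \<Rightarrow> complex) \<Rightarrow> complex) set" where
  "H_minus_half = {quarter_laplacian (dist_of g) | g. g \<in> L2}"

definition H_minus_half_norm :: "((real \<Rightarrow> complex) \<Rightarrow> complex) \<Rightarrow> real" where
  "H_minus_half_norm f =
     sqrt (\<Sum>\<^sub>\<infinity>m\<in>-{0}. inverse \<bar>real_of_int m\<bar> * (cmod (fourier_coeff f m))\<^sup>2)"

definition H_plus_L1 :: "((real \<Rightarrow> complex) \<Rightarrow> complex) set" where
  "H_plus_L1 = {(\<lambda>\<phi>. f \<phi> + dist_of g \<phi>) | f g. f \<in> H_minus_half \<and> g \<in> L1}"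

definition H_plus_L1_norm :: "((real \<Rightarrow> complex) \<Rightarrow> complex) \<Rightarrow> real" where
  "H_plus_L1_norm v = Inf {H_minus_half_norm f + L1_norm g | f g.
     f \<in> H_minus_half \<and> g \<in> L1 \<and> v = (\<lambda>\<phi>. f \<phi> + dist_of g \<phi>)}"

end

theory Submission
  imports Defs
begin

text \<open>
  The kernel \<open>\<Sum>m\<noteq>0. e^(imt) / m\<close> is a bounded sawtooth. Hence for \<open>g\<close> in L1 with Fourier
  coefficients \<open>c m\<close>, the sums of \<open>|c m|^2 / |m|\<close> over positive and over negative \<open>m\<close>, each possibly
  infinite, differ by at most a multiple of \<open>\<parallel>g\<parallel>^2\<close>. The combinations \<open>v \<mp> \<i> R v\<close> of
  \<open>v = (-\<Delta>)^(1/4) u\<close> with its Riesz transform have frequencies of one sign only; writing such a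
  combination as \<open>f + g\<close> with \<open>f\<close> in \<open>H^(-1/2)\<close> and \<open>g\<close> in L1, the coefficients of \<open>g\<close> on the empty
  side are those of \<open>-f\<close>, and the kernel bound transfers this control to the other side.
  The coefficients of \<open>u\<close> are then square summable off 0, and Riesz-Fischer provides \<open>u - mean u\<close>;
  it is identified with \<open>u\<close> because Fourier series of test functions converge with all derivatives.
\<close>

subsection \<open>Exponentials and test functions\<close>

abbreviation mode :: "int \<Rightarrow> real \<Rightarrow> complex" where
  "mode m \<equiv> \<lambda>x. cis (of_int m * x)"

lemma fourier_coeff_mode: "fourier_coeff u m = u (mode (- m)) / complex_of_real (2*pi)"
  by (simp add: fourier_coeff_def)

lemma mode_mult: "mode m x * mode n x = mode (m + n) x"
  by (simp add: cis_mult algebra_simps)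

lemma nth_deriv_0: "nth_deriv 0 f = f"
  by (simp add: nth_deriv_def)

lemma nth_deriv_Suc: "nth_deriv (Suc k) f = (\<lambda>x. vector_derivative (nth_deriv k f) (at x))"
  by (simp add: nth_deriv_def)

lemma nth_deriv_Suc': "nth_deriv (Suc k) f = nth_deriv k (\<lambda>x. vector_derivative f (at x))"
  by (simp only: nth_deriv_def funpow_Suc_right o_apply)

lemma has_vector_derivative_mode:
  "((\<lambda>x. c * mode m x) has_vector_derivative (\<i> * of_int m * c) * mode m x) (at x)"
  unfolding has_vector_derivative_def
  by (auto intro!: derivative_eq_intros simp: scaleR_conv_of_real algebra_simps)

lemma test_fun_nth_deriv_has_vector_derivative:
  assumes "test_fun \<phi>"
  shows "(nth_deriv k \<phi> has_vector_derivative nth_deriv (Suc k) \<phi> x) (at x)"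
  using assms by (simp add: test_fun_def nth_deriv_Suc vector_derivative_works)

lemma nth_deriv_lincomb:
  assumes "test_fun \<phi>" "test_fun \<psi>"
  shows "nth_deriv k (\<lambda>x. a * \<phi> x + b * \<psi> x) = (\<lambda>x. a * nth_deriv k \<phi> x + b * nth_deriv k \<psi> x)"
proof (induction k)
  case (Suc k)
  have "vector_derivative (\<lambda>x. a * nth_deriv k \<phi> x + b * nth_deriv k \<psi> x) (at x) =
        a * nth_deriv (Suc k) \<phi> x + b * nth_deriv (Suc k) \<psi> x" for x
    by (intro vector_derivative_at derivative_intros test_fun_nth_deriv_has_vector_derivative assms)
  then show ?case
    by (simp add: nth_deriv_Suc Suc)
qed (simp add: nth_deriv_0)

lemma test_fun_lincomb:
  assumes "test_fun \<phi>" "test_fun \<psi>"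
  shows "test_fun (\<lambda>x. a * \<phi> x + b * \<psi> x)"
  using assms unfolding nth_deriv_lincomb[OF assms] test_fun_def
  by (auto simp: nth_deriv_lincomb[OF assms] intro!: derivative_intros)

text \<open>Seminorms of all orders enter the continuity of a distribution, so derivatives must
  again be test functions. Periodicity is inherited because a periodic function and its translate
  coincide, and derivatives are unique.\<close>

lemma test_fun_deriv:
  assumes "test_fun \<phi>"
  shows "test_fun (nth_deriv k \<phi>)"
proof (induction k)
  case 0
  then show ?case using assms by (simp add: nth_deriv_0)
next
  case (Suc k)
  let ?f = "nth_deriv k \<phi>" and ?g = "nth_deriv (Suc k) \<phi>"
  have d: "(?f has_vector_derivative ?g x) (at x)" for x
    by (rule test_fun_nth_deriv_has_vector_derivative[OF assms])
  have per: "?f (x + 2*pi) = ?f x" for x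
    using Suc by (simp add: test_fun_def)
  have "?g (x + 2*pi) = ?g x" for x
  proof -
    have shift: "((\<lambda>y. y + 2*pi) has_vector_derivative 1) (at x)"
      unfolding has_real_derivative_iff_has_vector_derivative[symmetric]
      by (auto intro!: derivative_eq_intros)
    have "((\<lambda>y. ?f (y + 2*pi)) has_vector_derivative ?g (x + 2*pi)) (at x)"
      using vector_diff_chain_at[OF shift d] by (simp add: o_def)
    then have "(?f has_vector_derivative ?g (x + 2*pi)) (at x)"
      by (simp add: per)
    then show ?thesis
      using d vector_derivative_unique_at by blast
  qed
  \<comment> \<open>Smoothness of \<open>?g\<close> is that of \<open>?f\<close> with the order
    shifted by one; \<open>nth_deriv_Suc'\<close> puts the extra derivative on the inside.\<close>
  moreover have "nth_deriv j ?g = nth_deriv (Suc j) ?f" for j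
    by (simp only: nth_deriv_Suc'[of j] nth_deriv_Suc[of k])
  ultimately show ?case
    using Suc by (auto simp: test_fun_def)
qed

lemma nth_deriv_mode: "nth_deriv k (mode m) = (\<lambda>x. (\<i> * of_int m) ^ k * mode m x)"
proof (induction k)
  case (Suc k)
  have "vector_derivative (\<lambda>x. (\<i> * of_int m) ^ k * mode m x) (at x) = (\<i> * of_int m) ^ Suc k * mode m x" for x
    using vector_derivative_at[OF has_vector_derivative_mode] by simp
  then show ?case
    by (simp only: nth_deriv_Suc Suc)
qed (simp add: nth_deriv_0)

lemma test_fun_mode: "test_fun (mode m)"
proof -
  have "mode m (x + 2*pi) = mode m x" for x
  proof -
    have "mode m (x + 2*pi) = mode m x * cis (2 * pi * of_int m)"
      by (simp add: cis_mult algebra_simps)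
    then show ?thesis
      by (simp add: cis_multiple_2pi)
  qed
  then show ?thesis
    unfolding test_fun_def nth_deriv_mode
    using differentiableI_vector[OF has_vector_derivative_mode] by blast
qed

lemma test_fun_zero: "test_fun (\<lambda>_. 0)"
  using test_fun_lincomb[OF test_fun_mode test_fun_mode, where a=0 and b=0] by simp

lemma test_fun_sum:
  assumes "finite A" "\<And>i. i \<in> A \<Longrightarrow> test_fun (f i)"
  shows "test_fun (\<lambda>x. \<Sum>i\<in>A. c i * f i x)"
  using assms
proof (induction A rule: finite_induct)
  case (insert i A)
  then have "test_fun (\<lambda>x. c i * f i x + 1 * (\<Sum>i\<in>A. c i * f i x))"
    by (intro test_fun_lincomb) auto
  then show ?case using insert by simp
qed (simp add: test_fun_zero)

lemma nth_deriv_sum: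
  assumes "finite A" "\<And>i. i \<in> A \<Longrightarrow> test_fun (f i)"
  shows "nth_deriv k (\<lambda>x. \<Sum>i\<in>A. c i * f i x) = (\<lambda>x. \<Sum>i\<in>A. c i * nth_deriv k (f i) x)"
  using assms
proof (induction A rule: finite_induct)
  case empty
  show ?case
    using nth_deriv_lincomb[OF test_fun_mode test_fun_mode, where a=0 and b=0] by simp
next
  case (insert i A)
  then show ?case
    using nth_deriv_lincomb[where a="c i" and b=1 and \<phi>="f i" and \<psi>="\<lambda>x. \<Sum>i\<in>A. c i * f i x" and k=k]
    by (simp add: test_fun_sum)
qed

lemma test_fun_continuous: "test_fun \<phi> \<Longrightarrow> continuous_on A \<phi>"
  unfolding test_fun_def
  by (metis nth_deriv_0 continuous_at_imp_continuous_on differentiable_imp_continuous_within)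

lemma test_fun_periodic_int:
  assumes "test_fun \<phi>"
  shows "\<phi> (x + 2*pi * of_int k) = \<phi> x"
proof -
  have per: "\<phi> (x + 2*pi) = \<phi> x" for x
    using assms by (simp add: test_fun_def)
  have pern: "\<phi> (x + 2*pi * real n) = \<phi> x" for x n
  proof (induction n)
    case (Suc n)
    then show ?case using per[of "x + 2*pi * real n"] by (simp add: algebra_simps)
  qed simp
  show ?thesis
  proof (cases "k \<ge> 0")
    case True
    then show ?thesis using pern[of x "nat k"] by simp
  next
    case False
    then show ?thesis using pern[of "x + 2*pi * of_int k" "nat (- k)"] by simp
  qed
qed

text \<open>Compactness of one closed period, then translation by a multiple of \<open>2*pi\<close>.
  This is what makes the suprema in the seminorms meaningful.\<close>

lemma test_fun_bounded:
  assumes "test_fun \<phi>"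
  obtains B where "\<And>x. cmod (\<phi> x) \<le> B"
proof -
  have "compact (\<phi> ` {0..2*pi})"
    by (intro compact_continuous_image test_fun_continuous assms) auto
  then obtain B where B: "\<And>x. x \<in> {0..2*pi} \<Longrightarrow> cmod (\<phi> x) \<le> B"
    by (meson bounded_iff compact_imp_bounded imageI)
  have "cmod (\<phi> x) \<le> B" for x
  proof -
    define k where "k = \<lfloor>x / (2*pi)\<rfloor>"
    have "of_int k \<le> x / (2*pi)" "x / (2*pi) \<le> of_int k + 1"
      by (auto simp: k_def)
    then have "x + 2*pi * real_of_int (- k) \<in> {0..2*pi}"
      by (auto simp: field_simps)
    from B[OF this] show ?thesis by (simp only: test_fun_periodic_int[OF assms])
  qed
  then show ?thesis using that by blast
qed

section \<open>Integration over the circle\<close>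

interpretation circle: finite_measure circle
proof (rule finite_measure_lebesgue_on)
  show "{0..<2*pi} \<in> lmeasurable"
    by (rule bounded_set_imp_lmeasurable) auto
qed

lemma borel_measurable_circle: "continuous_on UNIV f \<Longrightarrow> f \<in> borel_measurable circle"
  for f :: "real \<Rightarrow> 'a::euclidean_space"
  by (rule continuous_imp_measurable_on_sets_lebesgue) (auto intro: continuous_on_subset)

lemma integrable_circle_continuous:
  fixes f :: "real \<Rightarrow> 'a::euclidean_space"
  assumes "continuous_on UNIV f"
  shows "integrable circle f"
proof -
  have "compact (f ` {0..2*pi})"
    by (intro compact_continuous_image continuous_on_subset[OF assms]) auto
  then obtain B where "\<And>x. x \<in> {0..2*pi} \<Longrightarrow> norm (f x) \<le> B"
    by (meson bounded_iff compact_imp_bounded imageI)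
  then show ?thesis
    by (intro circle.integrable_const_bound[of _ B] borel_measurable_circle assms AE_I2) auto
qed

text \<open>The half-open and the closed interval differ by a null point. On the closed one the
  fundamental theorem of calculus is available.\<close>

lemma integral_circle_continuous:
  fixes f :: "real \<Rightarrow> 'a::euclidean_space"
  assumes "continuous_on UNIV f"
  shows "(LINT x|circle. f x) = integral {0..2*pi} f"
proof -
  have "(LINT x|circle. f x) = integral {0..<2*pi} f"
    by (rule lebesgue_integral_eq_integral[OF integrable_circle_continuous[OF assms]]) simp
  also have "\<dots> = integral {0..2*pi} f"
  proof (rule integral_subset_negligible)
    have "{0..2*pi} - {0..<2*pi} \<subseteq> {2*pi}"
      by auto
    then show "negligible ({0..2*pi} - {0..<2*pi})"
      using negligible_sing negligible_subset by blast
  next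
    show "{0..<2*pi} \<subseteq> {0..2*pi}"
      by (intro subsetI) simp
  qed
  finally show ?thesis .
qed

text \<open>Source of both the orthogonality of the modes and integration by parts without boundary
  terms.\<close>

lemma integral_circle_periodic_derivative:
  assumes "\<And>x. (f has_vector_derivative f' x) (at x)" "continuous_on UNIV f'" "f (2*pi) = f 0"
  shows "(LINT x|circle. f' x) = (0::complex)"
proof -
  have "(f' has_integral (f (2*pi) - f 0)) {0..2*pi}"
    using assms(1) by (intro fundamental_theorem_of_calculus) (simp_all add: has_vector_derivative_at_within)
  then show ?thesis
    unfolding integral_circle_continuous[OF assms(2)] using assms(3) by (simp add: integral_unique)
qed

lemma continuous_on_mode [continuous_intros]: "continuous_on A (mode m)"
  by (rule test_fun_continuous[OF test_fun_mode])

lemma integral_mode: "(LINT x|circle. mode m x) = (if m = 0 then complex_of_real (2*pi) else 0)"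
proof (cases "m = 0")
  case True
  then show ?thesis by (simp add: measure_restrict_space scaleR_conv_of_real)
next
  case False
  have "(LINT x|circle. \<i> * of_int m * mode m x) = 0"
  proof (rule integral_circle_periodic_derivative)
    show "(mode m has_vector_derivative \<i> * of_int m * mode m x) (at x)" for x
      using has_vector_derivative_mode[of 1 m x] by simp
    show "mode m (2*pi) = mode m 0"
      using test_fun_mode[of m] unfolding test_fun_def by (metis add_0)
  qed (intro continuous_intros)
  with False show ?thesis by simp
qed

subsection \<open>Fourier coefficients and the Bessel inequality\<close>

text \<open>A continuous \<open>\<phi>\<close> may be unbounded on the line, but compactness bounds
  it on \<open>{0..2*pi}\<close>, and only these values matter for \<open>circle\<close>.\<close>

lemma integrable_circle_mult:
  fixes g \<phi> :: "real \<Rightarrow> complex"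
  assumes "integrable circle g" "continuous_on UNIV \<phi>"
  shows "integrable circle (\<lambda>x. g x * \<phi> x)"
proof -
  have "compact (\<phi> ` {0..2*pi})"
    by (intro compact_continuous_image continuous_on_subset[OF assms(2)]) auto
  then obtain B where B: "\<And>x. x \<in> {0..2*pi} \<Longrightarrow> norm (\<phi> x) \<le> B"
    by (meson bounded_iff compact_imp_bounded imageI)
  have "norm (g x * \<phi> x) \<le> norm (g x * of_real B)" if "x \<in> {0..<2*pi}" for x
    using B[of x] that by (auto simp: norm_mult intro!: mult_left_mono)
  then have "AE x in circle. norm (g x * \<phi> x) \<le> norm (g x * of_real B)"
    by (intro AE_I2) simp
  moreover have "(\<lambda>x. g x * \<phi> x) \<in> borel_measurable circle"
    by (rule borel_measurable_times[OF borel_measurable_integrable[OF assms(1)] borel_measurable_circle[OF assms(2)]])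
  moreover have "integrable circle (\<lambda>x. g x * of_real B)"
    using assms(1) by (rule integrable_mult_left)
  ultimately show ?thesis
    using Bochner_Integration.integrable_bound by blast
qed

lemma fourier_coeff_dist_of:
  "fourier_coeff (dist_of g) m = (LINT x|circle. g x * mode (- m) x) / complex_of_real (2*pi)"
  using test_fun_mode[of "- m"] by (simp add: fourier_coeff_mode dist_of_def)

text \<open>Testing against \<open>mode (- m)\<close> kills all terms but one by orthogonality, so
  the infinite sum collapses and the formula holds for arbitrary \<open>a\<close> and
  \<open>u\<close>.\<close>

lemma fourier_coeff_multiplier:
  "fourier_coeff (fourier_multiplier a u) m = a m * fourier_coeff u m"
proof -
  have i: "(LINT x|circle. mode k x * mode (- m) x) = (if k = m then complex_of_real (2*pi) else 0)" for k
    unfolding mode_mult integral_mode by simp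
  have "fourier_coeff (fourier_multiplier a u) m =
      (\<Sum>\<^sub>\<infinity>k\<in>UNIV. a k * fourier_coeff u k * (if k = m then complex_of_real (2*pi) else 0)) / complex_of_real (2*pi)"
    unfolding fourier_coeff_mode[of "fourier_multiplier a u"]
    using test_fun_mode[of "- m"] by (simp only: fourier_multiplier_def if_True i)
  also have "(\<Sum>\<^sub>\<infinity>k\<in>UNIV. a k * fourier_coeff u k * (if k = m then complex_of_real (2*pi) else 0)) =
      (\<Sum>\<^sub>\<infinity>k\<in>{m}. a k * fourier_coeff u k * (if k = m then complex_of_real (2*pi) else 0))"
    by (rule infsum_cong_neutral) auto
  finally show ?thesis by simp
qed

lemma L2_integrable:
  assumes "g \<in> L2"
  shows "integrable circle g"
proof (rule Bochner_Integration.integrable_bound)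
  show "integrable circle (\<lambda>x. 1 + (cmod (g x))\<^sup>2)" "g \<in> borel_measurable circle"
    using assms by (auto simp: L2_def)
  have "cmod z \<le> 1 + (cmod z)\<^sup>2" for z
    using sum_squares_ge_zero[of "cmod z - 1" "cmod z"]
    by (simp add: power2_eq_square algebra_simps)
  then show "AE x in circle. norm (g x) \<le> norm (1 + (cmod (g x))\<^sup>2)"
    by (intro AE_I2) (smt (verit) real_norm_def)
qed

lemma L2_continuous: "continuous_on UNIV g \<Longrightarrow> g \<in> L2"
  unfolding L2_def
  by (auto intro!: borel_measurable_circle integrable_circle_continuous continuous_intros)

lemma norm_add_sq_le: "(cmod (w + z))\<^sup>2 \<le> 2 * (cmod w)\<^sup>2 + 2 * (cmod z)\<^sup>2"
proof -
  have "(cmod (w + z))\<^sup>2 \<le> (cmod w + cmod z)\<^sup>2"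
    by (intro power_mono norm_triangle_ineq norm_ge_zero)
  also have "\<dots> \<le> 2 * (cmod w)\<^sup>2 + 2 * (cmod z)\<^sup>2"
    using zero_le_power2[of "cmod w - cmod z"] unfolding power2_diff power2_sum by linarith
  finally show ?thesis .
qed

lemma L2_diff:
  assumes "f \<in> L2" "g \<in> L2"
  shows "(\<lambda>x. f x - g x) \<in> L2"
proof -
  have [measurable]: "f \<in> borel_measurable circle" "g \<in> borel_measurable circle"
    using assms by (auto simp: L2_def)
  have *: "(cmod (w - z))\<^sup>2 \<le> 2 * (cmod w)\<^sup>2 + 2 * (cmod z)\<^sup>2" for w z
    using norm_add_sq_le[of w "- z"] by simp
  have "integrable circle (\<lambda>x. (cmod (f x - g x))\<^sup>2)"
    by (rule Bochner_Integration.integrable_bound[of circle "\<lambda>x. 2 * (cmod (f x))\<^sup>2 + 2 * (cmod (g x))\<^sup>2"])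
      (use assms * in \<open>auto simp: L2_def\<close>)
  then show ?thesis by (simp add: L2_def)
qed

lemma integral_trig_mode:
  assumes "finite A"
  shows "(LINT x|circle. (\<Sum>m\<in>A. c m * mode m x) * mode (- n) x) = (if n \<in> A then complex_of_real (2*pi) * c n else 0)"
proof -
  have "(LINT x|circle. (\<Sum>m\<in>A. c m * mode m x) * mode (- n) x) = (LINT x|circle. (\<Sum>m\<in>A. c m * mode (m - n) x))"
    unfolding sum_distrib_right mult.assoc mode_mult by simp
  also have "\<dots> = (\<Sum>m\<in>A. (LINT x|circle. c m * mode (m - n) x))"
    by (intro Bochner_Integration.integral_sum integrable_circle_continuous continuous_intros)
  also have "\<dots> = (\<Sum>m\<in>A. if m = n then complex_of_real (2*pi) * c n else 0)"
    unfolding integral_mult_right_zero integral_mode by (intro sum.cong) auto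
  finally show ?thesis using assms by (simp add: sum.delta)
qed

lemma fourier_coeff_trig:
  assumes "finite A"
  shows "fourier_coeff (dist_of (\<lambda>x. \<Sum>m\<in>A. c m * mode m x)) n = (if n \<in> A then c n else 0)"
  unfolding fourier_coeff_dist_of integral_trig_mode[OF assms] by simp

text \<open>Stated for integrable \<open>g\<close>, since it serves Bessel's inequality and also the
  sawtooth estimate, where \<open>g\<close> is only in L1.\<close>

lemma integral_mult_cnj_trig:
  assumes "integrable circle g"
  shows "(LINT x|circle. g x * cnj (\<Sum>m\<in>A. c m * mode m x)) =
    2*pi * (\<Sum>m\<in>A. cnj (c m) * fourier_coeff (dist_of g) m)"
proof -
  have "(LINT x|circle. g x * cnj (\<Sum>m\<in>A. c m * mode m x)) = (LINT x|circle. (\<Sum>m\<in>A. cnj (c m) * (g x * mode (- m) x)))"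
    by (intro Bochner_Integration.integral_cong refl)
       (simp add: sum_distrib_left mult.left_commute cis_cnj)
  also have "\<dots> = (\<Sum>m\<in>A. (LINT x|circle. cnj (c m) * (g x * mode (- m) x)))"
    by (intro Bochner_Integration.integral_sum integrable_mult_right integrable_circle_mult assms continuous_intros)
  also have "\<dots> = (\<Sum>m\<in>A. cnj (c m) * (2*pi * fourier_coeff (dist_of g) m))"
    by (simp add: fourier_coeff_dist_of)
  finally show ?thesis by (simp add: sum_distrib_left mult_ac)
qed

lemma integral_norm_trig:
  assumes "finite A"
  shows "(LINT x|circle. (cmod (\<Sum>m\<in>A. c m * mode m x))\<^sup>2) = 2*pi * (\<Sum>m\<in>A. (cmod (c m))\<^sup>2)"
proof -
  let ?S = "\<lambda>x. \<Sum>m\<in>A. c m * mode m x"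
  have "complex_of_real (LINT x|circle. (cmod (?S x))\<^sup>2) = (LINT x|circle. ?S x * cnj (?S x))"
    unfolding integral_complex_of_real[symmetric] complex_norm_square ..
  also have "\<dots> = 2*pi * (\<Sum>m\<in>A. cnj (c m) * fourier_coeff (dist_of ?S) m)"
    by (intro integral_mult_cnj_trig integrable_circle_continuous continuous_intros)
  also have "\<dots> = complex_of_real (2*pi * (\<Sum>m\<in>A. (cmod (c m))\<^sup>2))"
    unfolding of_real_mult of_real_sum complex_norm_square fourier_coeff_trig[OF assms]
    by (simp add: mult.commute)
  finally show ?thesis by (simp only: of_real_eq_iff)
qed

text \<open>Expand the integral of \<open>|g - S|^2\<close>, which is nonnegative, with
  \<open>S\<close> the partial Fourier sum over \<open>A\<close>: the integrals of
  \<open>Re (g * cnj S)\<close> and of \<open>|S|^2\<close> both equal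
  \<open>2*pi * E\<close>.\<close>

lemma bessel:
  assumes "g \<in> L2" "finite A"
  shows "2*pi * (\<Sum>m\<in>A. (cmod (fourier_coeff (dist_of g) m))\<^sup>2) \<le> (LINT x|circle. (cmod (g x))\<^sup>2)"
proof -
  define c where "c = fourier_coeff (dist_of g)"
  define E where "E = (\<Sum>m\<in>A. (cmod (c m))\<^sup>2)"
  let ?S = "\<lambda>x. \<Sum>m\<in>A. c m * mode m x"
  define R where "R = (\<lambda>x. Re (g x * cnj (?S x)))"
  have gi: "integrable circle g"
    by (rule L2_integrable[OF assms(1)])
  have i1: "integrable circle (\<lambda>x. g x * cnj (?S x))"
    by (rule integrable_circle_mult[OF gi]) (intro continuous_intros)
  have "(LINT x|circle. g x * cnj (?S x)) = 2*pi * (\<Sum>m\<in>A. cnj (c m) * c m)"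
    using integral_mult_cnj_trig[OF gi] by (simp add: c_def)
  also have "\<dots> = complex_of_real (2*pi * E)"
    unfolding E_def of_real_mult of_real_sum complex_norm_square by (simp add: mult.commute)
  finally have 1: "(LINT x|circle. R x) = 2*pi * E"
    unfolding R_def
    unfolding integral_Re[OF i1] by (simp only: Re_complex_of_real)
  have 2: "(LINT x|circle. (cmod (?S x))\<^sup>2) = 2*pi * E"
    unfolding E_def by (rule integral_norm_trig[OF assms(2)])
  have "0 \<le> (LINT x|circle. (cmod (g x - ?S x))\<^sup>2)"
    by simp
  also have "\<dots> = (LINT x|circle. (cmod (g x))\<^sup>2 - 2 * R x + (cmod (?S x))\<^sup>2)"
    unfolding R_def
    by (intro Bochner_Integration.integral_cong refl)
       (simp only: cmod_power2 minus_complex.simps times_complex.simps cnj.simps,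
        simp add: power2_eq_square algebra_simps)
  also have "\<dots> = (LINT x|circle. (cmod (g x))\<^sup>2) - 2 * (2*pi * E) + 2*pi * E"
  proof -
    have "integrable circle (\<lambda>x. (cmod (?S x))\<^sup>2)"
      by (intro integrable_circle_continuous continuous_intros)
    moreover have "integrable circle (\<lambda>x. (cmod (g x))\<^sup>2)"
      using assms by (simp add: L2_def)
    moreover have "integrable circle (\<lambda>x. 2 * R x)"
      unfolding R_def using i1 by (intro integrable_mult_right integrable_Re)
    ultimately show ?thesis
      using 1 2 by simp
  qed
  finally show ?thesis
    by (simp add: E_def c_def)
qed

subsection \<open>The sawtooth kernel\<close>

text \<open>Keeping opposite frequencies together isolates the sines in the sawtooth and later
  separates the two signs of frequency.\<close>

lemma sum_symmetric_int:
  fixes f :: "int \<Rightarrow> 'a::comm_monoid_add"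
  shows "(\<Sum>m\<in>{- int N..int N} - {0}. f m) = (\<Sum>k=1..N. f (int k) + f (- int k))"
proof (induction N)
  case (Suc N)
  have "{- int (Suc N)..int (Suc N)} - {0} =
      insert (int (Suc N)) (insert (- int (Suc N)) ({- int N..int N} - {0}))"
    by auto
  then show ?case
    using Suc by (simp add: add.assoc add.commute add.left_commute)
qed simp

text \<open>
  Summation by parts in closed form: adding the boundary term \<open>z ^ (N + 1) / (N + 1)\<close> to
  \<open>(1 - z) * (\<Sum>k=K+1..N. z ^ k / k)\<close> makes the increments telescope in norm.
\<close>

lemma norm_geometric_tail_le:
  fixes z :: complex
  assumes "cmod z = 1" "K \<le> N"
  shows "cmod ((1 - z) * (\<Sum>k=Suc K..N. z ^ k / of_nat k)) \<le> 2 / (real K + 1)"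
proof -
  define E where "E = (\<lambda>N. (1 - z) * (\<Sum>k=Suc K..N. z ^ k / of_nat k) + z ^ Suc N / of_nat (Suc N))"
  \<comment> \<open>At \<open>N = K\<close> the sum is empty and equality holds. Each step adds at
    most \<open>1 / (n + 1) - 1 / (n + 2)\<close>, and the final \<open>- 1 / (N + 1)\<close> pays
    for removing the boundary term.\<close>
  have "cmod (E N) \<le> 2 / (real K + 1) - 1 / (real N + 1)"
    using assms(2)
  proof (induction N rule: dec_induct)
    case base
    show ?case
      using assms(1) by (simp add: E_def norm_divide norm_power norm_mult del: of_nat_Suc power_Suc)
         (simp add: add.commute)
  next
    case (step n)
    have "E (Suc n) = E n - z ^ Suc (Suc n) * (1 / of_nat (Suc n) - 1 / of_nat (Suc (Suc n)))"
      using step(1) unfolding E_def by (simp add: field_simps del: of_nat_Suc)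
    also have "1 / of_nat (Suc n) - 1 / of_nat (Suc (Suc n)) =
        complex_of_real (1 / (real n + 1) - 1 / (real n + 2))"
      by (simp add: add.commute)
    finally have "cmod (E (Suc n)) \<le> cmod (E n) + cmod (z ^ Suc (Suc n) * complex_of_real (1 / (real n + 1) - 1 / (real n + 2)))"
      by (metis norm_triangle_ineq4)
    also have "cmod (z ^ Suc (Suc n) * complex_of_real (1 / (real n + 1) - 1 / (real n + 2))) =
        1 / (real n + 1) - 1 / (real n + 2)"
      unfolding norm_mult norm_power norm_of_real assms(1) by (simp add: field_simps)
    finally show ?case
      using step(3) by (simp add: add.commute)
  qed
  moreover have "cmod (z ^ Suc N / of_nat (Suc N)) = 1 / (real N + 1)"
    using assms(1) by (simp add: norm_divide norm_power norm_mult add.commute del: of_nat_Suc power_Suc)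
  ultimately show ?thesis
    using norm_triangle_ineq4[of "E N" "z ^ Suc N / of_nat (Suc N)"] by (simp add: E_def)
qed

text \<open>Cut at \<open>K\<close>, the integer part of \<open>1 / d\<close> with
  \<open>d = |1 - cis t|\<close>. Each term is at most \<open>d\<close>, so the head is at most
  \<open>K * d \<le> 1\<close>; the geometric tail is at most
  \<open>2 / ((K + 1) * d) \<le> 2\<close>. For \<open>d = 0\<close> all terms vanish.\<close>

lemma sum_sin_over_k_le: "\<bar>\<Sum>k=1..N. sin (real k * t) / real k\<bar> \<le> 3"
proof -
  define z where "z = cis t"
  define d where "d = cmod (1 - z)"
  have z1: "cmod z = 1" by (simp add: z_def)
  have zk: "sin (real k * t) / real k = Im (z ^ k / of_nat k)" for k
    by (simp add: z_def Complex.DeMoivre Im_divide_of_nat)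
  have head: "\<bar>\<Sum>k=1..n. sin (real k * t) / real k\<bar> \<le> real n * d" for n
  proof -
    have "\<bar>sin (real k * t) / real k\<bar> \<le> d" if "k \<ge> 1" for k
    proof -
      have "\<bar>sin (real k * t)\<bar> = \<bar>Im (z ^ k - 1)\<bar>"
        by (simp add: z_def Complex.DeMoivre)
      also have "\<dots> \<le> cmod (z ^ k - 1 ^ k)"
        using abs_Im_le_cmod[of "z ^ k - 1"] by simp
      also have "\<dots> \<le> real k * cmod (z - 1)"
        using z1 by (intro norm_power_diff) auto
      finally show ?thesis
        using that by (simp add: d_def norm_minus_commute field_simps)
    qed
    then have "\<bar>\<Sum>k=1..n. sin (real k * t) / real k\<bar> \<le> (\<Sum>k=1..n. d)"
      by (intro order.trans[OF sum_abs] sum_mono) auto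
    then show ?thesis by simp
  qed
  show ?thesis
  proof (cases "d = 0")
    case True
    then show ?thesis using head[of N] by simp
  next
    case False
    then have d0: "d > 0" by (simp add: d_def)
    define K where "K = nat \<lfloor>1 / d\<rfloor>"
    have K: "real K \<le> 1 / d" "1 / d \<le> real K + 1"
      using d0 by (auto simp: K_def)
    have K1: "real K * d \<le> 1" "1 \<le> (real K + 1) * d"
      using K d0 by (auto simp: field_simps)
    show ?thesis
    proof (cases "N \<le> K")
      case True
      then have "real N * d \<le> real K * d"
        using d0 by (intro mult_right_mono) auto
      then show ?thesis using head[of N] K1 by linarith
    next
      case False
      have "(\<Sum>k=1..N. sin (real k * t) / real k) =
          (\<Sum>k=1..K. sin (real k * t) / real k) + (\<Sum>k=Suc K..N. sin (real k * t) / real k)"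
        using False sum.ub_add_nat[of 1 K "\<lambda>k. sin (real k * t) / real k" "N - K"] by simp
      moreover have "\<bar>\<Sum>k=Suc K..N. sin (real k * t) / real k\<bar> \<le> 2"
      proof -
        have "\<bar>\<Sum>k=Suc K..N. sin (real k * t) / real k\<bar> \<le> cmod (\<Sum>k=Suc K..N. z ^ k / of_nat k)"
          unfolding zk Im_sum[symmetric] by (rule abs_Im_le_cmod)
        moreover have "d * cmod (\<Sum>k=Suc K..N. z ^ k / of_nat k) \<le> 2 / (real K + 1)"
          using norm_geometric_tail_le[OF z1, of K N] False by (simp add: norm_mult d_def)
        then have "cmod (\<Sum>k=Suc K..N. z ^ k / of_nat k) * ((real K + 1) * d) \<le> 2"
          by (simp add: field_simps)
        moreover have "cmod (\<Sum>k=Suc K..N. z ^ k / of_nat k) * 1 \<le>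
            cmod (\<Sum>k=Suc K..N. z ^ k / of_nat k) * ((real K + 1) * d)"
          using K1 by (intro mult_left_mono) auto
        ultimately show ?thesis by linarith
      qed
      ultimately show ?thesis using head[of K] K1 by linarith
    qed
  qed
qed

text \<open>Pairing \<open>m\<close> with \<open>- m\<close> cancels the cosines and leaves
  \<open>2 * \<i> * sin (k * t) / k\<close>. The cancellation is essential: the one-sided sums have
  a logarithmic singularity at 0.\<close>

lemma norm_sawtooth_sum_le: "cmod (\<Sum>m\<in>{- int N..int N} - {0}. mode m t / complex_of_int m) \<le> 6"
proof -
  have "mode (int k) t / of_int (int k) + mode (- int k) t / of_int (- int k) =
      2 * \<i> * complex_of_real (sin (real k * t) / real k)" for k
    by (simp add: complex_eq_iff diff_divide_distrib[symmetric] Re_divide_of_nat Im_divide_of_nat)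
  then have "(\<Sum>m\<in>{- int N..int N} - {0}. mode m t / complex_of_int m) =
      2 * \<i> * complex_of_real (\<Sum>k=1..N. sin (real k * t) / real k)"
    unfolding sum_symmetric_int by (simp add: sum_distrib_left)
  then show ?thesis
    using sum_sin_over_k_le[of t N] by (simp add: norm_mult del: of_real_sum)
qed

text \<open>Up to the factor \<open>2*pi\<close>, the signed sum is the pairing of \<open>g\<close>
  with its convolution \<open>S\<close> with the sawtooth kernel. As the kernel is bounded,
  \<open>S\<close> is bounded by a multiple of \<open>L1_norm g\<close>, and the pairing by a
  multiple of its square, uniformly in \<open>N\<close>.\<close>

lemma fourier_coeff_signed_sum_le:
  assumes "g \<in> L1"
  shows "\<bar>\<Sum>k=1..N. ((cmod (fourier_coeff (dist_of g) (int k)))\<^sup>2 -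
      (cmod (fourier_coeff (dist_of g) (- int k)))\<^sup>2) / real k\<bar> \<le> (L1_norm g)\<^sup>2"
proof -
  define A where "A = {- int N..int N} - {0}"
  define c where "c = fourier_coeff (dist_of g)"
  define S where "S = (\<lambda>x. \<Sum>m\<in>A. (c m / of_int m) * mode m x)"
  have gi: "integrable circle g"
    using assms by (simp add: L1_def)
  \<comment> \<open>\<open>2*pi * S x\<close> is the integral of \<open>g y\<close> against the
    kernel at \<open>x - y\<close>, whose norm is at most 6.\<close>
  have Sb: "cmod (S x) \<le> 6 * L1_norm g / (2*pi)" for x
  proof -
    have shift: "mode m x * mode (- m) y = mode m (x - y)" for m y
      by (simp add: cis_mult algebra_simps)
    have "complex_of_real (2*pi) * S x = (\<Sum>m\<in>A. (LINT y|circle. mode m x / of_int m * (g y * mode (- m) y)))"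
      unfolding integral_mult_right_zero
      by (simp add: S_def c_def fourier_coeff_dist_of sum_distrib_left mult_ac)
    also have "\<dots> = (LINT y|circle. (\<Sum>m\<in>A. mode m x / of_int m * (g y * mode (- m) y)))"
      by (intro Bochner_Integration.integral_sum[symmetric] integrable_mult_right integrable_circle_mult gi continuous_intros)
    also have "\<dots> = (LINT y|circle. g y * (\<Sum>m\<in>A. mode m (x - y) / of_int m))"
      by (intro Bochner_Integration.integral_cong refl)
         (simp add: sum_distrib_left shift[symmetric] mult_ac)
    also have "cmod \<dots> \<le> (LINT y|circle. cmod (g y) * 6)"
    proof (rule Bochner_Integration.integral_norm_bound_integral)
      show "integrable circle (\<lambda>y. g y * (\<Sum>m\<in>A. mode m (x - y) / complex_of_int m))"
        unfolding shift[symmetric] divide_inverse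
        by (intro integrable_circle_mult gi continuous_intros)
      show "cmod (g y * (\<Sum>m\<in>A. mode m (x - y) / complex_of_int m)) \<le> cmod (g y) * 6" for y
        unfolding norm_mult A_def by (intro mult_left_mono norm_sawtooth_sum_le norm_ge_zero)
    qed (use gi in auto)
    also have "\<dots> = 6 * L1_norm g"
      by (simp add: L1_norm_def)
    finally show ?thesis
      by (simp add: norm_mult field_simps)
  qed
  have Sc: "continuous_on UNIV S"
    unfolding S_def by (intro continuous_intros)
  have "(LINT x|circle. g x * cnj (S x)) = complex_of_real (2*pi) * (\<Sum>m\<in>A. cnj (c m / of_int m) * c m)"
    using integral_mult_cnj_trig[OF gi, of "\<lambda>m. c m / of_int m" A] by (simp add: S_def c_def)
  also have "(\<Sum>m\<in>A. cnj (c m / of_int m) * c m) = complex_of_real (\<Sum>m\<in>A. (cmod (c m))\<^sup>2 / of_int m)"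
    unfolding of_real_sum of_real_divide complex_norm_square by (simp add: mult.commute)
  finally have "2*pi * \<bar>\<Sum>m\<in>A. (cmod (c m))\<^sup>2 / of_int m\<bar> = cmod (LINT x|circle. g x * cnj (S x))"
    by (simp add: norm_mult del: of_real_sum)
  also have "\<dots> \<le> (LINT x|circle. cmod (g x) * (6 * L1_norm g / (2*pi)))"
  proof (rule Bochner_Integration.integral_norm_bound_integral)
    show "integrable circle (\<lambda>x. g x * cnj (S x))"
      by (intro integrable_circle_mult gi continuous_intros Sc)
    show "cmod (g x * cnj (S x)) \<le> cmod (g x) * (6 * L1_norm g / (2*pi))" for x
      unfolding norm_mult complex_mod_cnj by (intro mult_left_mono Sb norm_ge_zero)
  qed (use gi in auto)
  also have "\<dots> = 6 * (L1_norm g)\<^sup>2 / (2*pi)"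
    unfolding integral_mult_left_zero by (simp add: L1_norm_def power2_eq_square)
  \<comment> \<open>Rounds the constant \<open>6 / (2*pi)^2\<close> up to 1.\<close>
  also have "\<dots> \<le> 2*pi * (L1_norm g)\<^sup>2"
  proof -
    have "6 * (L1_norm g)\<^sup>2 \<le> (2*pi * (2*pi)) * (L1_norm g)\<^sup>2"
      using mult_mono[of 3 "2*pi" 3 "2*pi"] pi_gt3 by (intro mult_right_mono) auto
    then show ?thesis by (simp add: field_simps)
  qed
  finally have "\<bar>\<Sum>m\<in>A. (cmod (c m))\<^sup>2 / of_int m\<bar> \<le> (L1_norm g)\<^sup>2"
    by simp
  then show ?thesis
    unfolding A_def sum_symmetric_int c_def by (simp add: diff_divide_distrib)
qed

subsection \<open>Fourier series of test functions and distributions\<close>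

text \<open>The chord has length \<open>2 * |sin (s / 2)|\<close>, which is comparable to the arc
  \<open>|s|\<close> on half a turn in either direction.\<close>

lemma norm_cis_minus_one_ge:
  assumes "\<bar>s\<bar> \<le> pi"
  shows "\<bar>s\<bar> \<le> 2 * cmod (cis s - 1)"
proof -
  \<comment> \<open>The Taylor error of the sine at \<open>s / 2\<close> is at most
    \<open>s^3 / 48\<close>, and \<open>3.2^2 / 48 < 1/4\<close>.\<close>
  have *: "s / 2 \<le> 2 * sin (s / 2)" if s: "0 \<le> s" "s \<le> pi" for s :: real
  proof -
    have "s \<le> 3.2"
      using s pi_approx by simp
    then have "s * (s * s) \<le> s * (3.2 * 3.2)"
      using s by (intro mult_mono) auto
    moreover have "\<bar>sin (s / 2) - s / 2\<bar> \<le> s * (s * s) / 48"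
      using Maclaurin_sin_bound[of "s / 2" 3] s
      by (simp add: sin_coeff_def eval_nat_numeral)
    ultimately show ?thesis
      using s by linarith
  qed
  have "(cmod (cis s - 1))\<^sup>2 = (2 * sin (s / 2))\<^sup>2"
  proof -
    have "cos s = 1 - 2 * (sin (s / 2))\<^sup>2"
      using cos_double_sin[of "s / 2"] by simp
    moreover have "(cmod (cis s - 1))\<^sup>2 = 2 - 2 * cos s"
      using sin_cos_squared_add[of s] by (simp add: cmod_power2 power2_diff)
    ultimately show ?thesis by (simp add: power_mult_distrib)
  qed
  then have "cmod (cis s - 1) = \<bar>2 * sin (s / 2)\<bar>"
    by (metis abs_norm_cancel power2_eq_iff_nonneg abs_ge_zero norm_ge_zero power2_abs)
  moreover have "\<bar>s\<bar> / 2 \<le> 2 * \<bar>sin (s / 2)\<bar>"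
  proof (cases "s \<ge> 0")
    case True
    then show ?thesis using *[of s] assms by linarith
  next
    case False
    then show ?thesis using *[of "- s"] assms by simp
  qed
  ultimately show ?thesis by (simp add: abs_mult)
qed

text \<open>A bounded derivative gives a Lipschitz bound in the arc length, which is traded for the
  chord length. It keeps the quotient in Chernoff's argument bounded.\<close>

lemma test_fun_diff_le_cis:
  assumes "test_fun \<phi>"
  obtains M where "\<And>y. cmod (\<phi> y - \<phi> x) \<le> M * cmod (cis (y - x) - 1)"
proof -
  obtain L where L: "\<And>x. cmod (nth_deriv 1 \<phi> x) \<le> L"
    using test_fun_bounded[OF test_fun_deriv[OF assms]] by metis
  then have L0: "L \<ge> 0"
    using norm_ge_zero order_trans by blast
  have lip: "cmod (\<phi> a - \<phi> b) \<le> L * \<bar>a - b\<bar>" for a b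
  proof -
    have "norm (\<phi> a - \<phi> b) \<le> L * norm (a - b)"
    proof (rule differentiable_bound[of UNIV \<phi> "\<lambda>x h. h *\<^sub>R nth_deriv 1 \<phi> x"])
      fix x :: real
      show "(\<phi> has_derivative (\<lambda>h. h *\<^sub>R nth_deriv 1 \<phi> x)) (at x)"
        using test_fun_nth_deriv_has_vector_derivative[OF assms, of 0 x]
        by (simp add: nth_deriv_0 has_vector_derivative_def)
      show "onorm (\<lambda>h. h *\<^sub>R nth_deriv 1 \<phi> x) \<le> L"
        by (rule onorm_bound[OF L0]) (use L[of x] in \<open>simp add: mult_left_mono mult.commute[of L]\<close>)
    qed auto
    then show ?thesis by simp
  qed
  have "cmod (\<phi> y - \<phi> x) \<le> (2 * L) * cmod (cis (y - x) - 1)" for y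
  proof -
    \<comment> \<open>Rounding selects the representative \<open>s\<close> of \<open>y - x\<close>
      modulo \<open>2*pi\<close> with \<open>|s| \<le> pi\<close>.\<close>
    define k where "k = round ((y - x) / (2*pi))"
    define s where "s = y - x - 2*pi * of_int k"
    have "\<bar>(y - x) / (2*pi) - of_int k\<bar> \<le> 1 / 2"
      using of_int_round_abs_le[of "(y - x) / (2*pi)"] by (simp add: k_def abs_minus_commute)
    then have "\<bar>2*pi * ((y - x) / (2*pi) - of_int k)\<bar> \<le> 2*pi * (1 / 2)"
      unfolding abs_mult by (intro mult_mono) auto
    moreover have "2*pi * ((y - x) / (2*pi) - of_int k) = s"
      by (simp add: s_def field_simps)
    ultimately have s: "\<bar>s\<bar> \<le> pi"
      by simp
    have "\<phi> y = \<phi> (x + s)"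
      using test_fun_periodic_int[OF assms, of "x + s" k] by (simp add: s_def)
    then have "cmod (\<phi> y - \<phi> x) \<le> L * \<bar>s\<bar>"
      using lip[of "x + s" x] by simp
    also have "\<dots> \<le> L * (2 * cmod (cis s - 1))"
      by (intro mult_left_mono norm_cis_minus_one_ge s L0)
    also have "cis s = cis (y - x)"
    proof -
      have "cis (y - x) = cis s * cis (2*pi * of_int k)"
        unfolding s_def cis_mult by simp
      then show ?thesis by (simp add: cis_multiple_2pi)
    qed
    finally show ?thesis by simp
  qed
  then show ?thesis using that by blast
qed

text \<open>Riemann-Lebesgue from Bessel's inequality. An arbitrary injective \<open>f\<close>
  covers both ends \<open>N\<close> and \<open>- N - 1\<close> of the telescoping sum below.\<close>

lemma fourier_coeff_LIMSEQ_zero: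
  assumes "g \<in> L2" "inj f"
  shows "(\<lambda>n::nat. fourier_coeff (dist_of g) (f n)) \<longlonglongrightarrow> 0"
proof -
  have "(\<Sum>n<N. (cmod (fourier_coeff (dist_of g) (f n)))\<^sup>2) \<le> (LINT x|circle. (cmod (g x))\<^sup>2) / (2*pi)" for N
  proof -
    have "(\<Sum>n<N. (cmod (fourier_coeff (dist_of g) (f n)))\<^sup>2) = (\<Sum>m\<in>f ` {..<N}. (cmod (fourier_coeff (dist_of g) m))\<^sup>2)"
      using assms(2) by (subst sum.reindex) (auto intro: inj_on_subset)
    then show ?thesis
      using bessel[OF assms(1), of "f ` {..<N}"] by (simp add: field_simps)
  qed
  then have "summable (\<lambda>n. (cmod (fourier_coeff (dist_of g) (f n)))\<^sup>2)"
    by (intro summableI_nonneg_bounded) auto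
  then have "(\<lambda>n. (cmod (fourier_coeff (dist_of g) (f n)))\<^sup>2) \<longlonglongrightarrow> 0"
    by (rule summable_LIMSEQ_zero)
  then show ?thesis
    using tendsto_norm_zero_iff by (fastforce simp: tendsto_null_power)
qed

text \<open>
  Chernoff's argument: \<open>\<phi> - \<phi> x\<close> is a bounded multiple \<open>q\<close> of \<open>cis (y - x) - 1\<close>, which turns
  the partial sums of its Fourier series at \<open>x\<close> into telescoping sums of coefficients of \<open>q\<close>.
\<close>

lemma fourier_series_LIMSEQ:
  assumes "test_fun \<phi>"
  shows "(\<lambda>N. \<Sum>m\<in>{- int N..int N}. fourier_coeff (dist_of \<phi>) m * mode m x) \<longlonglongrightarrow> \<phi> x"
proof -
  have \<phi>c: "continuous_on UNIV \<phi>"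
    by (rule test_fun_continuous[OF assms])
  obtain M where M: "\<And>y. cmod (\<phi> y - \<phi> x) \<le> M * cmod (cis (y - x) - 1)"
    using test_fun_diff_le_cis[OF assms] by metis
  \<comment> \<open>Where \<open>cis (y - x) = 1\<close>, division gives 0 by convention; there the
    bound with \<open>M\<close> forces \<open>\<phi> y = \<phi> x\<close>, so the product identity
    for \<open>q\<close> still holds.\<close>
  define q where "q = (\<lambda>y. (\<phi> y - \<phi> x) / (cis (y - x) - 1))"
  have q: "q y * (cis (y - x) - 1) = \<phi> y - \<phi> x" for y
    using M[of y] by (auto simp: q_def)
  have qb: "cmod (q y) \<le> \<bar>M\<bar>" for y
  proof (cases "cis (y - x) = 1")
    case False
    then have "cmod (q y) \<le> M"
      using M[of y] by (simp add: q_def norm_divide field_simps)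
    then show ?thesis by simp
  qed (simp add: q_def)
  have qm: "q \<in> borel_measurable circle"
    unfolding q_def
    by (intro borel_measurable_divide borel_measurable_circle continuous_intros \<phi>c)
  have qi: "integrable circle q"
    by (rule finite_measure.integrable_const_bound[OF circle.finite_measure_axioms _ qm, of "\<bar>M\<bar>"]) (simp add: qb)
  have "integrable circle (\<lambda>y. (cmod (q y))\<^sup>2)"
  proof (rule finite_measure.integrable_const_bound[OF circle.finite_measure_axioms])
    show "AE y in circle. norm ((cmod (q y))\<^sup>2) \<le> \<bar>M\<bar>\<^sup>2"
      by (intro AE_I2) (simp only: real_norm_def abs_power2 power_mono[OF qb norm_ge_zero])
  qed (use qm in measurable)
  then have qL2: "q \<in> L2"
    using qm by (simp add: L2_def)
  define d where "d = (\<lambda>m. fourier_coeff (dist_of q) m * mode m x)"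
  \<comment> \<open>Multiplication by \<open>cis (y - x)\<close> shifts the frequency by one, so
    each term is a difference of consecutive \<open>d\<close>; the constant \<open>\<phi> x\<close>
    contributes only at \<open>m = 0\<close>.\<close>
  have coeff: "fourier_coeff (dist_of \<phi>) m * mode m x = (if m = 0 then \<phi> x else 0) + (d (m - 1) - d m)" for m
  proof -
    have "(LINT y|circle. \<phi> y * mode (- m) y) =
        (LINT y|circle. \<phi> x * mode (- m) y + (cis (- x) * (q y * mode (- (m - 1)) y) - q y * mode (- m) y))"
    proof (intro Bochner_Integration.integral_cong refl)
      fix y
      have "cis (y - x) * mode (- m) y = cis (- x) * mode (- (m - 1)) y"
        by (simp add: cis_mult algebra_simps)
      then have "q y * (cis (y - x) - 1) * mode (- m) y = cis (- x) * (q y * mode (- (m - 1)) y) - q y * mode (- m) y"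
        by (simp add: algebra_simps)
      then show "\<phi> y * mode (- m) y = \<phi> x * mode (- m) y + (cis (- x) * (q y * mode (- (m - 1)) y) - q y * mode (- m) y)"
        unfolding q by (simp add: algebra_simps)
    qed
    also have "\<dots> = (LINT y|circle. \<phi> x * mode (- m) y) +
        ((LINT y|circle. cis (- x) * (q y * mode (- (m - 1)) y)) - (LINT y|circle. q y * mode (- m) y))"
    proof -
      have "integrable circle (\<lambda>y. \<phi> x * mode (- m) y)"
        by (intro integrable_circle_continuous continuous_intros)
      moreover have i: "integrable circle (\<lambda>y. q y * mode k y)" for k
        by (intro integrable_circle_mult qi continuous_intros)
      moreover have "integrable circle (\<lambda>y. cis (- x) * (q y * mode (- (m - 1)) y))"
        by (intro integrable_mult_right i)
      ultimately show ?thesis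
        by (simp only: Bochner_Integration.integral_add Bochner_Integration.integral_diff Bochner_Integration.integrable_diff)
    qed
    also have "\<dots> = \<phi> x * (if m = 0 then complex_of_real (2*pi) else 0) +
        (cis (- x) * (complex_of_real (2*pi) * fourier_coeff (dist_of q) (m - 1)) - complex_of_real (2*pi) * fourier_coeff (dist_of q) m)"
      unfolding integral_mult_right_zero integral_mode fourier_coeff_dist_of by simp
    finally have coeff: "fourier_coeff (dist_of \<phi>) m =
        (if m = 0 then \<phi> x else 0) + (cis (- x) * fourier_coeff (dist_of q) (m - 1) - fourier_coeff (dist_of q) m)"
      unfolding fourier_coeff_dist_of[of \<phi>]
      by (simp add: add_divide_distrib diff_divide_distrib)
    have shift: "mode (m - 1) x = cis (- x) * mode m x"
      by (simp add: cis_mult algebra_simps)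
    show ?thesis
      unfolding d_def coeff shift by (simp add: algebra_simps)
  qed
  have "(\<Sum>m\<in>{- int N..int N}. fourier_coeff (dist_of \<phi>) m * mode m x) = \<phi> x + (d (- int N - 1) - d (int N))" for N
  proof -
    have "(\<Sum>m\<in>{- int N..int N}. d (m - 1) - d m) = d (- int N - 1) - d (int N)"
    proof (induction N)
      case (Suc N)
      have "{- int (Suc N)..int (Suc N)} = insert (int (Suc N)) (insert (- int (Suc N)) {- int N..int N})"
        by auto
      moreover have "d (- 1 - int N) = d (- int N - 1)"
        by (rule arg_cong[of _ _ d]) simp
      ultimately show ?case using Suc by (simp add: algebra_simps)
    qed simp
    moreover have "(\<Sum>m\<in>{- int N..int N}. if m = 0 then \<phi> x else 0) = \<phi> x"
      by (simp add: sum.delta)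
    ultimately show ?thesis
      unfolding coeff sum.distrib by simp
  qed
  moreover have dlim: "(\<lambda>N. d (f N)) \<longlonglongrightarrow> 0" if "inj f" for f :: "nat \<Rightarrow> int"
    using tendsto_norm_zero[OF fourier_coeff_LIMSEQ_zero[OF qL2 that]]
    by (intro tendsto_norm_zero_cancel[of "\<lambda>N. d (f N)"]) (simp add: d_def norm_mult)
  have "(\<lambda>N. \<phi> x + (d (- int N - 1) - d (int N))) \<longlonglongrightarrow> \<phi> x + (0 - 0)"
    by (intro tendsto_intros dlim) (auto simp: inj_on_def)
  ultimately show ?thesis by simp
qed

lemma test_fun_bdd_above:
  assumes "test_fun \<phi>"
  shows "bdd_above (range (\<lambda>x. cmod (\<phi> x)))"
  using test_fun_bounded[OF assms] by (metis bdd_aboveI2)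

text \<open>Integration by parts: the derivative of the periodic product with
  \<open>mode (- m)\<close> has integral 0.\<close>

lemma fourier_coeff_nth_deriv:
  assumes "test_fun \<phi>"
  shows "fourier_coeff (dist_of (nth_deriv k \<phi>)) m = (\<i> * of_int m) ^ k * fourier_coeff (dist_of \<phi>) m"
proof (induction k)
  case (Suc k)
  let ?f = "nth_deriv k \<phi>" and ?g = "nth_deriv (Suc k) \<phi>"
  have c: "continuous_on UNIV ?f" "continuous_on UNIV ?g"
    using assms by (auto intro!: test_fun_continuous test_fun_deriv)
  have per: "\<psi> (2*pi) = \<psi> 0" if "test_fun \<psi>" for \<psi>
    using that unfolding test_fun_def by (metis add_0)
  have "(LINT x|circle. ?g x * mode (- m) x + ?f x * (- (\<i> * of_int m) * mode (- m) x)) = 0"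
  proof (rule integral_circle_periodic_derivative)
    show "((\<lambda>x. ?f x * mode (- m) x) has_vector_derivative
        ?g x * mode (- m) x + ?f x * (- (\<i> * of_int m) * mode (- m) x)) (at x)" for x
      using has_vector_derivative_mult[OF test_fun_nth_deriv_has_vector_derivative[OF assms, of k x]
          has_vector_derivative_mode[of 1 "- m" x]]
      by (simp add: add.commute)
    show "?f (2*pi) * mode (- m) (2*pi) = ?f 0 * mode (- m) 0"
      using per[OF test_fun_deriv[OF assms]] per[OF test_fun_mode] by metis
  qed (intro continuous_intros c)
  also have "(\<lambda>x. ?g x * mode (- m) x + ?f x * (- (\<i> * of_int m) * mode (- m) x)) =
      (\<lambda>x. ?g x * mode (- m) x - (\<i> * of_int m) * (?f x * mode (- m) x))"
    by (simp add: algebra_simps)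
  also have "(LINT x|circle. ?g x * mode (- m) x - (\<i> * of_int m) * (?f x * mode (- m) x)) =
      (LINT x|circle. ?g x * mode (- m) x) - (\<i> * of_int m) * (LINT x|circle. ?f x * mode (- m) x)"
    unfolding integral_mult_right_zero[symmetric]
    by (intro Bochner_Integration.integral_diff integrable_circle_continuous continuous_intros c)
  finally have "fourier_coeff (dist_of ?g) m = (\<i> * of_int m) * fourier_coeff (dist_of ?f) m"
    unfolding fourier_coeff_dist_of by simp
  then show ?case
    by (simp add: Suc mult.assoc)
qed (simp add: nth_deriv_0)

lemma norm_fourier_coeff_le:
  assumes "integrable circle g" "\<And>x. cmod (g x) \<le> B"
  shows "cmod (fourier_coeff (dist_of g) m) \<le> B"
proof -
  have "cmod (LINT x|circle. g x * mode (- m) x) \<le> (LINT x|circle. B)"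
    using assms
    by (intro Bochner_Integration.integral_norm_bound_integral integrable_circle_mult continuous_intros)
       (auto simp: norm_mult)
  also have "\<dots> = 2*pi * B"
    by (simp add: measure_restrict_space)
  finally show ?thesis
    by (simp add: fourier_coeff_dist_of norm_divide field_simps)
qed

text \<open>Two integrations by parts give coefficients of size \<open>m^-2\<close>, so the series converges absolutely.\<close>

lemma fourier_coeff_abs_convergent:
  assumes "test_fun \<phi>"
  shows "convergent (\<lambda>N. \<Sum>m\<in>{- int N..int N}. cmod (fourier_coeff (dist_of \<phi>) m))"
proof -
  define c where "c = (\<lambda>m. cmod (fourier_coeff (dist_of \<phi>) m))"
  obtain B where B: "\<And>x. cmod (nth_deriv 2 \<phi> x) \<le> B"
    using test_fun_bounded[OF test_fun_deriv[OF assms]] by metis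
  have cB: "c m \<le> B / (of_int m)\<^sup>2" if "m \<noteq> 0" for m
  proof -
    have "integrable circle (nth_deriv 2 \<phi>)"
      by (intro integrable_circle_continuous test_fun_continuous test_fun_deriv assms)
    then have "cmod (fourier_coeff (dist_of (nth_deriv 2 \<phi>)) m) \<le> B"
      by (rule norm_fourier_coeff_le) (rule B)
    then have "(of_int m)\<^sup>2 * c m \<le> B"
      unfolding fourier_coeff_nth_deriv[OF assms] c_def by (simp add: norm_mult norm_power)
    then show ?thesis
      using that by (simp add: field_simps)
  qed
  have "summable (\<lambda>k. c (int (Suc k)) + c (- int (Suc k)))"
  proof (rule summable_comparison_test)
    have "summable (\<lambda>k. inverse ((real (Suc k))\<^sup>2))"
      using inverse_power_summable[of 2, where 'a=real] by (subst summable_Suc_iff) simp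
    then show "summable (\<lambda>k. 2 * B * inverse ((real (Suc k))\<^sup>2))"
      by (rule summable_mult)
    have "norm (c (int (Suc k)) + c (- int (Suc k))) \<le> 2 * B * inverse ((real (Suc k))\<^sup>2)" for k
    proof -
      have "c (int (Suc k)) \<le> B * inverse ((real (Suc k))\<^sup>2)"
        using cB[of "int (Suc k)"] by (simp add: divide_inverse)
      moreover have "c (- int (Suc k)) \<le> B * inverse ((real (Suc k))\<^sup>2)"
        using cB[of "- int (Suc k)"] unfolding of_int_minus power2_minus by (simp add: divide_inverse)
      ultimately show ?thesis
        by (simp add: c_def)
    qed
    then show "\<exists>K. \<forall>k\<ge>K. norm (c (int (Suc k)) + c (- int (Suc k))) \<le> 2 * B * inverse ((real (Suc k))\<^sup>2)"
      by blast
  qed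
  then have "convergent (\<lambda>N. c 0 + (\<Sum>k<N. c (int (Suc k)) + c (- int (Suc k))))"
    unfolding summable_iff_convergent by (intro convergent_add convergent_const)
  moreover have "(\<Sum>m\<in>{- int N..int N}. c m) = c 0 + (\<Sum>k<N. c (int (Suc k)) + c (- int (Suc k)))" for N
  proof -
    have "(\<Sum>m\<in>{- int N..int N}. c m) = c 0 + (\<Sum>m\<in>{- int N..int N} - {0}. c m)"
      by (rule sum.remove) auto
    also have "(\<Sum>m\<in>{- int N..int N} - {0}. c m) = (\<Sum>k<N. c (int (Suc k)) + c (- int (Suc k)))"
      unfolding sum_symmetric_int
      by (rule sum.reindex_bij_witness[of _ Suc "\<lambda>k. k - 1"]) auto
    finally show ?thesis .
  qed
  ultimately show ?thesis
    by (simp add: c_def)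
qed

text \<open>The pointwise limit is already known to be \<open>\<phi>\<close>, so absolute
  convergence of the coefficients bounds the remainder by their tail \<open>t - T N\<close>,
  independently of \<open>x\<close>.\<close>

lemma fourier_series_uniform:
  assumes "test_fun \<phi>"
  shows "(\<lambda>N. SUP x. cmod (\<phi> x - (\<Sum>m\<in>{- int N..int N}. fourier_coeff (dist_of \<phi>) m * mode m x))) \<longlonglongrightarrow> 0"
proof -
  define c where "c = fourier_coeff (dist_of \<phi>)"
  define S where "S = (\<lambda>N x. \<Sum>m\<in>{- int N..int N}. c m * mode m x)"
  define T where "T = (\<lambda>N. \<Sum>m\<in>{- int N..int N}. cmod (c m))"
  obtain t where t: "T \<longlonglongrightarrow> t"
    using fourier_coeff_abs_convergent[OF assms] unfolding T_def c_def convergent_def by blast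
  have tail: "cmod (\<phi> x - S N x) \<le> t - T N" for N x
  proof (rule LIMSEQ_le)
    show "(\<lambda>M. cmod (S M x - S N x)) \<longlonglongrightarrow> cmod (\<phi> x - S N x)"
      using fourier_series_LIMSEQ[OF assms, of x] unfolding S_def c_def by (intro tendsto_intros)
    show "(\<lambda>M. T M - T N) \<longlonglongrightarrow> t - T N"
      using t by (intro tendsto_intros)
    have "cmod (S M x - S N x) \<le> T M - T N" if "M \<ge> N" for M
    proof -
      have sub: "{- int N..int N} \<subseteq> {- int M..int M}"
        using that by auto
      have "S M x - S N x = (\<Sum>m\<in>{- int M..int M} - {- int N..int N}. c m * mode m x)"
        unfolding S_def using sub by (subst sum_diff) auto
      also have "cmod \<dots> \<le> (\<Sum>m\<in>{- int M..int M} - {- int N..int N}. cmod (c m))"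
        by (intro sum_norm_le) (simp add: norm_mult)
      also have "\<dots> = T M - T N"
        unfolding T_def using sub by (subst sum_diff) auto
      finally show ?thesis .
    qed
    then show "\<exists>K. \<forall>M\<ge>K. cmod (S M x - S N x) \<le> T M - T N"
      by blast
  qed
  have "(\<lambda>N. SUP x. cmod (\<phi> x - S N x)) \<longlonglongrightarrow> 0"
  proof (rule tendsto_sandwich)
    show "\<forall>\<^sub>F N in sequentially. 0 \<le> (SUP x. cmod (\<phi> x - S N x))"
    proof (intro always_eventually allI)
      fix N
      have "cmod (\<phi> 0 - S N 0) \<le> (SUP x. cmod (\<phi> x - S N x))"
        by (rule cSUP_upper) (use tail in \<open>auto intro!: bdd_aboveI2\<close>)
      then show "0 \<le> (SUP x. cmod (\<phi> x - S N x))"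
        using norm_ge_zero order_trans by blast
    qed
    show "\<forall>\<^sub>F N in sequentially. (SUP x. cmod (\<phi> x - S N x)) \<le> t - T N"
      by (intro always_eventually allI cSUP_least tail) auto
    show "(\<lambda>N. t - T N) \<longlonglongrightarrow> 0"
      using tendsto_diff[OF tendsto_const t, of t] by simp
  qed auto
  then show ?thesis
    by (simp add: S_def c_def)
qed

section \<open>Distributions evaluated on Fourier series\<close>

lemma distribution_lincomb:
  assumes "distribution u" "test_fun \<phi>" "test_fun \<psi>"
  shows "u (\<lambda>x. a * \<phi> x + b * \<psi> x) = a * u \<phi> + b * u \<psi>"
  using assms by (simp add: distribution_def)

lemma distribution_sum:
  assumes "distribution u" "finite A" "\<And>i. i \<in> A \<Longrightarrow> test_fun (f i)"
  shows "u (\<lambda>x. \<Sum>i\<in>A. c i * f i x) = (\<Sum>i\<in>A. c i * u (f i))"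
  using assms(2,3)
proof (induction A rule: finite_induct)
  case empty
  show ?case
    using distribution_lincomb[OF assms(1) test_fun_zero test_fun_zero, of 0 0] by simp
next
  case (insert i A)
  then show ?case
    using distribution_lincomb[OF assms(1), of "f i" "\<lambda>x. \<Sum>i\<in>A. c i * f i x" "c i" 1]
    by (simp add: test_fun_sum)
qed

text \<open>The continuity bound is applied to \<open>\<phi>\<close> minus its partial sum, whose
  finitely many relevant seminorms tend to 0. Hence a distribution is determined by its values on
  the modes.\<close>

lemma distribution_LIMSEQ:
  assumes "distribution u" "test_fun \<phi>"
  shows "(\<lambda>N. \<Sum>m\<in>{- int N..int N}. fourier_coeff (dist_of \<phi>) m * u (mode m)) \<longlonglongrightarrow> u \<phi>"
proof -
  define c where "c = fourier_coeff (dist_of \<phi>)"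
  define S where "S = (\<lambda>N x. \<Sum>m\<in>{- int N..int N}. c m * mode m x)"
  define D where "D = (\<lambda>N x. 1 * \<phi> x + (- 1) * S N x)"
  obtain K n where K: "\<And>\<psi>. test_fun \<psi> \<Longrightarrow> cmod (u \<psi>) \<le> K * (\<Sum>k\<le>n. SUP x. cmod (nth_deriv k \<psi> x))"
    using assms(1) unfolding distribution_def by blast
  have tS: "test_fun (S N)" for N
    unfolding S_def by (intro test_fun_sum test_fun_mode) auto
  have tD: "test_fun (D N)" for N
    unfolding D_def by (rule test_fun_lincomb[OF assms(2) tS])
  have "(\<lambda>N. SUP x. cmod (nth_deriv k (D N) x)) \<longlonglongrightarrow> 0" for k
  proof -
    have "nth_deriv k (S N) = (\<lambda>x. \<Sum>m\<in>{- int N..int N}. c m * nth_deriv k (mode m) x)" for N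
      unfolding S_def by (intro nth_deriv_sum test_fun_mode) auto
    \<comment> \<open>The derivative of a partial sum is the partial sum of the derivative, so
      uniform convergence applies to each order.\<close>
    then have "nth_deriv k (D N) x = nth_deriv k \<phi> x -
        (\<Sum>m\<in>{- int N..int N}. fourier_coeff (dist_of (nth_deriv k \<phi>)) m * mode m x)" for N x
      unfolding D_def nth_deriv_lincomb[OF assms(2) tS] nth_deriv_mode fourier_coeff_nth_deriv[OF assms(2)]
      by (simp add: c_def mult_ac)
    then show ?thesis
      using fourier_series_uniform[OF test_fun_deriv[OF assms(2), of k]] by presburger
  qed
  then have "(\<lambda>N. K * (\<Sum>k\<le>n. SUP x. cmod (nth_deriv k (D N) x))) \<longlonglongrightarrow> K * (\<Sum>k\<le>n. 0)"
    by (intro tendsto_intros)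
  then have K0: "(\<lambda>N. K * (\<Sum>k\<le>n. SUP x. cmod (nth_deriv k (D N) x))) \<longlonglongrightarrow> 0"
    by simp
  have "(\<lambda>N. u (D N)) \<longlonglongrightarrow> 0"
    by (rule Lim_null_comparison[OF always_eventually K0]) (simp add: K tD)
  moreover have "u (D N) = u \<phi> - (\<Sum>m\<in>{- int N..int N}. c m * u (mode m))" for N
  proof -
    have "u (S N) = (\<Sum>m\<in>{- int N..int N}. c m * u (mode m))"
      unfolding S_def by (intro distribution_sum assms test_fun_mode) auto
    then show ?thesis
      unfolding D_def distribution_lincomb[OF assms(1,2) tS] by simp
  qed
  ultimately have "(\<lambda>N. u \<phi> - (\<Sum>m\<in>{- int N..int N}. c m * u (mode m))) \<longlonglongrightarrow> 0"
    by simp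
  from tendsto_diff[OF tendsto_const this, of "u \<phi>"] show ?thesis
    by (simp add: c_def)
qed

text \<open>The seminorm of order 0 suffices, with constant \<open>L1_norm g\<close>. This makes
  \<open>distribution_LIMSEQ\<close> available for functions.\<close>

lemma distribution_dist_of:
  assumes "integrable circle g"
  shows "distribution (dist_of g)"
  unfolding distribution_def
proof (intro conjI allI impI)
  show "dist_of g \<phi> = 0" if "\<not> test_fun \<phi>" for \<phi>
    using that by (simp add: dist_of_def)
next
  fix \<phi> \<psi> a b assume *: "test_fun \<phi>" "test_fun \<psi>"
  have "(LINT x|circle. g x * (a * \<phi> x + b * \<psi> x)) = (LINT x|circle. a * (g x * \<phi> x) + b * (g x * \<psi> x))"
    by (simp add: algebra_simps)
  also have "\<dots> = a * (LINT x|circle. g x * \<phi> x) + b * (LINT x|circle. g x * \<psi> x)"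
    unfolding integral_mult_right_zero[symmetric]
    by (intro Bochner_Integration.integral_add integrable_mult_right integrable_circle_mult assms test_fun_continuous *)
  finally show "dist_of g (\<lambda>x. a * \<phi> x + b * \<psi> x) = a * dist_of g \<phi> + b * dist_of g \<psi>"
    using * by (simp add: dist_of_def test_fun_lincomb)
next
  have "cmod (dist_of g \<phi>) \<le> L1_norm g * (\<Sum>k\<le>0. SUP x. cmod (nth_deriv k \<phi> x))" if "test_fun \<phi>" for \<phi>
  proof -
    have "cmod (LINT x|circle. g x * \<phi> x) \<le> (LINT x|circle. cmod (g x) * (SUP x. cmod (\<phi> x)))"
    proof (rule Bochner_Integration.integral_norm_bound_integral)
      show "integrable circle (\<lambda>x. g x * \<phi> x)"
        by (intro integrable_circle_mult assms test_fun_continuous that)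
      show "cmod (g x * \<phi> x) \<le> cmod (g x) * (SUP x. cmod (\<phi> x))" for x
        unfolding norm_mult by (intro mult_left_mono cSUP_upper test_fun_bdd_above that) auto
    qed (use assms in auto)
    then show ?thesis
      using that by (simp add: dist_of_def L1_norm_def nth_deriv_0)
  qed
  then show "\<exists>(K::real) (N::nat). \<forall>\<phi>. test_fun \<phi> \<longrightarrow>
      cmod (dist_of g \<phi>) \<le> K * (\<Sum>k\<le>N. SUP x. cmod (nth_deriv k \<phi> x))"
    by blast
qed

lemma fourier_coeff_dist_of_lincomb:
  assumes "integrable circle f" "integrable circle g"
  shows "fourier_coeff (dist_of (\<lambda>x. a * f x + b * g x)) m =
    a * fourier_coeff (dist_of f) m + b * fourier_coeff (dist_of g) m"
proof -
  have "(LINT x|circle. (a * f x + b * g x) * mode (- m) x) =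
      (LINT x|circle. a * (f x * mode (- m) x) + b * (g x * mode (- m) x))"
    by (simp add: algebra_simps)
  also have "\<dots> = a * (LINT x|circle. f x * mode (- m) x) + b * (LINT x|circle. g x * mode (- m) x)"
    unfolding integral_mult_right_zero[symmetric]
    by (intro Bochner_Integration.integral_add integrable_mult_right integrable_circle_mult assms continuous_intros)
  finally show ?thesis
    unfolding fourier_coeff_dist_of by (simp add: add_divide_distrib)
qed

subsection \<open>The Riesz-Fischer theorem\<close>

text \<open>Fatou's lemma, used both for the limit in Riesz-Fischer and for its distance to the
  partial sums.\<close>

lemma L2_fatou:
  assumes "\<And>i::nat. s i \<in> L2" "\<And>i. (LINT x|circle. (cmod (s i x))\<^sup>2) \<le> B"
    and "AE x in circle. (\<lambda>i. s i x) \<longlonglongrightarrow> v x" "v \<in> borel_measurable circle"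
  shows "v \<in> L2" "(LINT x|circle. (cmod (v x))\<^sup>2) \<le> B"
proof -
  have sm [measurable]: "s i \<in> borel_measurable circle" for i
    using assms(1) by (simp add: L2_def)
  have vm [measurable]: "v \<in> borel_measurable circle"
    by (rule assms)
  have B0: "0 \<le> B"
    using assms(2)[of 0] by (rule order_trans[rotated]) simp
  have "(\<integral>\<^sup>+x. ennreal ((cmod (v x))\<^sup>2) \<partial>circle) = (\<integral>\<^sup>+x. liminf (\<lambda>i. ennreal ((cmod (s i x))\<^sup>2)) \<partial>circle)"
  proof (rule nn_integral_cong_AE)
    show "AE x in circle. ennreal ((cmod (v x))\<^sup>2) = liminf (\<lambda>i. ennreal ((cmod (s i x))\<^sup>2))"
      using assms(3)
    proof eventually_elim
      case (elim x)
      then have "(\<lambda>i. ennreal ((cmod (s i x))\<^sup>2)) \<longlonglongrightarrow> ennreal ((cmod (v x))\<^sup>2)"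
        by (intro tendsto_intros tendsto_ennrealI)
      then show ?case
        by (rule lim_imp_Liminf[OF sequentially_bot, symmetric])
    qed
  qed
  also have "\<dots> \<le> liminf (\<lambda>i. \<integral>\<^sup>+x. ennreal ((cmod (s i x))\<^sup>2) \<partial>circle)"
    by (rule nn_integral_liminf) measurable
  also have "\<dots> \<le> liminf (\<lambda>i::nat. ennreal B)"
  proof (rule Liminf_mono, intro always_eventually allI)
    show "(\<integral>\<^sup>+x. ennreal ((cmod (s i x))\<^sup>2) \<partial>circle) \<le> ennreal B" for i
      using assms(1,2)[of i] by (subst nn_integral_eq_integral) (auto simp: L2_def intro: ennreal_leI)
  qed
  also have "\<dots> = ennreal B"
    by (simp add: Liminf_const)
  finally have *: "(\<integral>\<^sup>+x. ennreal ((cmod (v x))\<^sup>2) \<partial>circle) \<le> ennreal B" .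
  have i: "integrable circle (\<lambda>x. (cmod (v x))\<^sup>2)"
    using * by (intro integrableI_nonneg) (auto simp: le_less_trans[OF _ ennreal_less_top])
  then show "v \<in> L2"
    by (simp add: L2_def vm)
  show "(LINT x|circle. (cmod (v x))\<^sup>2) \<le> B"
    using * B0 by (subst (asm) nn_integral_eq_integral[OF i]) auto
qed

text \<open>A Young-type substitute for Cauchy-Schwarz; the free parameter \<open>e\<close> lets
  smallness in L2 pass to L1.\<close>

lemma L1_norm_le_L2:
  assumes "f \<in> L2" "e > 0"
  shows "(LINT x|circle. cmod (f x)) \<le> 2*pi * e + (LINT x|circle. (cmod (f x))\<^sup>2) / e"
proof -
  have "(LINT x|circle. cmod (f x)) \<le> (LINT x|circle. e + (cmod (f x))\<^sup>2 / e)"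
  proof (rule Bochner_Integration.integral_mono)
    show "integrable circle (\<lambda>x. cmod (f x))"
      using L2_integrable[OF assms(1)] by simp
    show "integrable circle (\<lambda>x. e + (cmod (f x))\<^sup>2 / e)"
      using assms(1) by (auto simp: L2_def)
    have *: "e * z \<le> e\<^sup>2 + z\<^sup>2" for z :: real
      using zero_le_power2[of "z - e"] zero_le_power2[of z] zero_le_power2[of e]
      unfolding power2_diff mult.assoc mult.commute[of z e] by linarith
    show "cmod (f x) \<le> e + (cmod (f x))\<^sup>2 / e" for x
      using assms(2) *[of "cmod (f x)"] by (simp add: field_simps power2_eq_square)
  qed
  also have "\<dots> = 2*pi * e + (LINT x|circle. (cmod (f x))\<^sup>2) / e"
    using assms(1) by (subst Bochner_Integration.integral_add) (auto simp: L2_def measure_restrict_space)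
  finally show ?thesis .
qed

text \<open>The partial sums are Cauchy in L2, hence in L1, so a subsequence converges almost
  everywhere. Fatou bounds the limit and its distance to the partial sums, and Bessel then
  identifies its coefficients.\<close>

lemma riesz_fischer:
  fixes a :: "int \<Rightarrow> complex"
  assumes "\<And>A. finite A \<Longrightarrow> (\<Sum>m\<in>A. (cmod (a m))\<^sup>2) \<le> E"
  obtains v where "v \<in> L2" "\<And>m. fourier_coeff (dist_of v) m = a m"
    "(LINT x|circle. (cmod (v x))\<^sup>2) \<le> 2*pi * E"
proof -
  define s where "s = (\<lambda>N x. \<Sum>m\<in>{- int N..int N}. a m * mode m x)"
  define T where "T = (\<lambda>N. \<Sum>m\<in>{- int N..int N}. (cmod (a m))\<^sup>2)"
  have sc: "continuous_on UNIV (s N)" for N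
    unfolding s_def by (intro continuous_intros)
  have sL2: "s N \<in> L2" for N
    by (rule L2_continuous[OF sc])
  have sdL2: "(\<lambda>x. s M x - s N x) \<in> L2" for M N
    by (intro L2_diff sL2)
  have "incseq T"
    unfolding T_def by (intro incseq_SucI sum_mono2) auto
  moreover have TE: "T N \<le> E" for N
    unfolding T_def by (intro assms) simp
  ultimately obtain t where t: "T \<longlonglongrightarrow> t" and Tt: "\<And>N. T N \<le> t"
    using incseq_convergent[of T E] by metis
  have dist_le: "(LINT x|circle. (cmod (s M x - s N x))\<^sup>2) = 2*pi * (T M - T N)" if "N \<le> M" for M N
  proof -
    have sub: "{- int N..int N} \<subseteq> {- int M..int M}"
      using that by auto
    have "s M x - s N x = (\<Sum>m\<in>{- int M..int M} - {- int N..int N}. a m * mode m x)" for x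
      unfolding s_def using sub by (subst sum_diff) auto
    then have "(LINT x|circle. (cmod (s M x - s N x))\<^sup>2) =
        2*pi * (\<Sum>m\<in>{- int M..int M} - {- int N..int N}. (cmod (a m))\<^sup>2)"
      by (simp only: integral_norm_trig finite_Diff finite_atLeastAtMost_int)
    also have "\<dots> = 2*pi * (T M - T N)"
      unfolding T_def using sub by (subst sum_diff) auto
    finally show ?thesis .
  qed
  have dist_abs: "(LINT x|circle. (cmod (s M x - s N x))\<^sup>2) = 2*pi * \<bar>T M - T N\<bar>" for M N
  proof (cases "N \<le> M")
    case True
    then show ?thesis
      using dist_le incseqD[OF \<open>incseq T\<close>] by auto
  next
    case False
    then show ?thesis
      using dist_le[of M N] incseqD[OF \<open>incseq T\<close>, of M N] by (simp add: norm_minus_commute)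
  qed
  have cauchy: "\<exists>N. \<forall>i\<ge>N. \<forall>j\<ge>N. (LINT x|circle. norm (s i x - s j x)) < e" if "e > 0" for e
  proof -
    \<comment> \<open>Makes the term \<open>2*pi * \<delta>\<close> in \<open>L1_norm_le_L2\<close>
      equal to \<open>e / 2\<close>; the threshold for \<open>T\<close> below keeps the other term
      under \<open>e / 2\<close>.\<close>
    define \<delta> where "\<delta> = e / (4*pi)"
    have \<delta>: "\<delta> > 0" "2*pi * \<delta> = e / 2"
      using that by (auto simp: \<delta>_def)
    have "0 < \<delta> * (e / 2) / (2*pi)"
      using \<delta> that by simp
    then obtain N where N: "\<And>i j. i \<ge> N \<Longrightarrow> j \<ge> N \<Longrightarrow> \<bar>T i - T j\<bar> < \<delta> * (e / 2) / (2*pi)"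
      using LIMSEQ_imp_Cauchy[OF t] unfolding Cauchy_def dist_real_def by meson
    have "(LINT x|circle. norm (s i x - s j x)) < e" if "i \<ge> N" "j \<ge> N" for i j
    proof -
      have "2*pi * \<bar>T i - T j\<bar> < \<delta> * (e / 2)"
        using N[OF that] by (simp add: field_simps)
      then have "2*pi * \<bar>T i - T j\<bar> / \<delta> < e / 2"
        using \<delta>(1) by (simp add: field_simps)
      then show ?thesis
        using L1_norm_le_L2[OF sdL2[of i j] \<delta>(1)] unfolding dist_abs \<delta>(2) by linarith
    qed
    then show ?thesis by blast
  qed
  obtain r where r: "strict_mono r" "AE x in circle. Cauchy (\<lambda>i. s (r i) x)"
    by (rule cauchy_L1_AE_cauchy_subseq[OF L2_integrable[OF sL2] cauchy])
  define v where "v = (\<lambda>x. lim (\<lambda>i. s (r i) x))"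
  have lim: "AE x in circle. (\<lambda>i. s (r i) x) \<longlonglongrightarrow> v x"
    using r(2)
  proof eventually_elim
    case (elim x)
    then show ?case
      unfolding v_def using Cauchy_convergent_iff convergent_LIMSEQ_iff by blast
  qed
  have vm: "v \<in> borel_measurable circle"
    unfolding v_def by (intro borel_measurable_lim_metric borel_measurable_circle sc)
  have sE: "(LINT x|circle. (cmod (s N x))\<^sup>2) \<le> 2*pi * E" for N
    using TE[of N] unfolding s_def T_def by (subst integral_norm_trig) auto
  note v = L2_fatou[of "\<lambda>i. s (r i)", OF sL2 sE lim vm]
  \<comment> \<open>The offset in \<open>r (i + n)\<close> guarantees an index of at least
    \<open>n\<close>, so \<open>dist_le\<close> applies for every \<open>i\<close>.\<close>
  have vs: "(LINT x|circle. (cmod (v x - s n x))\<^sup>2) \<le> 2*pi * (t - T n)" for n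
  proof (rule L2_fatou(2)[of "\<lambda>i x. s (r (i + n)) x - s n x"])
    have "n \<le> r (i + n)" for i
      using strict_mono_imp_increasing[OF r(1), of "i + n"] by simp
    then show "(LINT x|circle. (cmod (s (r (i + n)) x - s n x))\<^sup>2) \<le> 2*pi * (t - T n)" for i
      using dist_le[of n "r (i + n)"] Tt[of "r (i + n)"] by simp
    show "AE x in circle. (\<lambda>i. s (r (i + n)) x - s n x) \<longlonglongrightarrow> v x - s n x"
      using lim
    proof eventually_elim
      case (elim x)
      then show ?case
        by (intro tendsto_intros) (rule LIMSEQ_ignore_initial_segment)
    qed
    show "(\<lambda>x. v x - s n x) \<in> borel_measurable circle"
      by (intro borel_measurable_diff vm borel_measurable_circle sc)
  qed (rule sdL2)
  have "fourier_coeff (dist_of v) m = a m" for m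
  proof -
    let ?d = "(cmod (fourier_coeff (dist_of v) m - a m))\<^sup>2"
    \<comment> \<open>Once \<open>n \<ge> |m|\<close>, \<open>s n\<close> has coefficient
      \<open>a m\<close>; Bessel at this single frequency bounds the error by the L2 distance from
      \<open>v\<close> to \<open>s n\<close>.\<close>
    have "?d \<le> t - T n" if "n \<ge> nat \<bar>m\<bar>" for n
    proof -
      have "m \<in> {- int n..int n}"
        using that by auto
      then have "fourier_coeff (dist_of (s n)) m = a m"
        unfolding s_def by (subst fourier_coeff_trig) auto
      then have "fourier_coeff (dist_of (\<lambda>x. v x - s n x)) m = fourier_coeff (dist_of v) m - a m"
        using fourier_coeff_dist_of_lincomb[OF L2_integrable[OF v(1)] L2_integrable[OF sL2], of 1 "-1"] by simp
      then have "2*pi * ?d \<le> 2*pi * (t - T n)"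
        using order_trans[OF bessel[OF L2_diff[OF v(1) sL2[of n]], of "{m}"] vs[of n]] by simp
      then show ?thesis by simp
    qed
    moreover have "(\<lambda>n. t - T n) \<longlonglongrightarrow> t - t"
      using t by (intro tendsto_intros)
    ultimately have "?d \<le> t - t"
      by (intro LIMSEQ_le_const) blast+
    then show ?thesis by simp
  qed
  with v show ?thesis
    using that by blast
qed

subsection \<open>The one-sided estimate\<close>

text \<open>An \<open>infsum\<close> is 0 when the family is not summable, so summability comes
  first. It follows from Bessel for the L2 function behind \<open>f\<close>, since the weight
  \<open>1 / |m|\<close> cancels the squared multiplier.\<close>

lemma H_minus_half_sum_le:
  assumes "f \<in> H_minus_half" "finite A" "0 \<notin> A"
  shows "(\<Sum>m\<in>A. (cmod (fourier_coeff f m))\<^sup>2 / \<bar>of_int m\<bar>) \<le> (H_minus_half_norm f)\<^sup>2"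
proof -
  define w where "w = (\<lambda>m. inverse \<bar>real_of_int m\<bar> * (cmod (fourier_coeff f m))\<^sup>2)"
  obtain g where g: "g \<in> L2" "f = quarter_laplacian (dist_of g)"
    using assms(1) by (auto simp: H_minus_half_def)
  have w: "w m = (cmod (fourier_coeff (dist_of g) m))\<^sup>2" if "m \<noteq> 0" for m
    using that unfolding w_def g(2) quarter_laplacian_def fourier_coeff_multiplier
    by (simp add: norm_mult power_mult_distrib)
  have "sum w F \<le> (LINT x|circle. (cmod (g x))\<^sup>2) / (2*pi)" if "finite F" "F \<subseteq> - {0}" for F
  proof -
    have "sum w F = (\<Sum>m\<in>F. (cmod (fourier_coeff (dist_of g) m))\<^sup>2)"
      using that by (intro sum.cong refl w) auto
    then show ?thesis
      using bessel[OF g(1) that(1)] by (simp add: field_simps)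
  qed
  then have "w summable_on - {0}"
    by (intro nonneg_bounded_partial_sums_imp_summable_on[where C = "(LINT x|circle. (cmod (g x))\<^sup>2) / (2*pi)"])
       (auto simp: w_def eventually_finite_subsets_at_top)
  then have "sum w A \<le> infsum w (- {0})"
    using assms by (intro finite_sum_le_infsum) (auto simp: w_def)
  also have "\<dots> = (H_minus_half_norm f)\<^sup>2"
    unfolding H_minus_half_norm_def w_def[symmetric]
    by (subst real_sqrt_pow2) (auto intro!: infsum_nonneg simp: w_def)
  finally show ?thesis
    by (simp add: w_def divide_inverse mult.commute)
qed

text \<open>On the empty side the coefficients of \<open>g\<close> are minus those of
  \<open>f\<close>, with weighted sum at most \<open>X\<close>. The sawtooth inequality carries this
  to the side of \<open>\<sigma>\<close> at the cost of \<open>(L1_norm g)^2\<close>, and squaring a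
  sum doubles \<open>X + (X + (L1_norm g)^2)\<close>.\<close>

lemma fourier_coeff_one_sided_sum_le:
  fixes f :: "int \<Rightarrow> complex"
  assumes "\<sigma> = 1 \<or> \<sigma> = - 1" "g \<in> L1"
    and f: "\<And>A. finite A \<Longrightarrow> 0 \<notin> A \<Longrightarrow> (\<Sum>m\<in>A. (cmod (f m))\<^sup>2 / \<bar>of_int m\<bar>) \<le> X"
    and vanish: "\<And>k::nat. k \<ge> 1 \<Longrightarrow> f (- \<sigma> * int k) + fourier_coeff (dist_of g) (- \<sigma> * int k) = 0"
  shows "(\<Sum>k=1..N. (cmod (f (\<sigma> * int k) + fourier_coeff (dist_of g) (\<sigma> * int k)))\<^sup>2 / real k)
    \<le> 4 * X + 2 * (L1_norm g)\<^sup>2"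
proof -
  define c where "c = fourier_coeff (dist_of g)"
  have fX: "(\<Sum>k=1..N. (cmod (f (\<tau> * int k)))\<^sup>2 / real k) \<le> X" if "\<tau> = 1 \<or> \<tau> = - 1" for \<tau>
  proof -
    have "(\<Sum>k=1..N. (cmod (f (\<tau> * int k)))\<^sup>2 / real k) =
        (\<Sum>m\<in>(\<lambda>k. \<tau> * int k) ` {1..N}. (cmod (f m))\<^sup>2 / \<bar>of_int m\<bar>)"
      using that by (subst sum.reindex) (auto simp: inj_on_def abs_mult)
    also have "\<dots> \<le> X"
      using that by (intro f) auto
    finally show ?thesis .
  qed
  have "(\<Sum>k=1..N. (cmod (c (- \<sigma> * int k)))\<^sup>2 / real k) = (\<Sum>k=1..N. (cmod (f (- \<sigma> * int k)))\<^sup>2 / real k)"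
  proof (intro sum.cong refl)
    fix k assume "k \<in> {1..N}"
    then have "c (- \<sigma> * int k) = - f (- \<sigma> * int k)"
      using vanish[of k] by (simp add: c_def add_eq_0_iff)
    then show "(cmod (c (- \<sigma> * int k)))\<^sup>2 / real k = (cmod (f (- \<sigma> * int k)))\<^sup>2 / real k"
      by (simp only: norm_minus_cancel)
  qed
  then have neg: "(\<Sum>k=1..N. (cmod (c (- \<sigma> * int k)))\<^sup>2 / real k) \<le> X"
    using fX[of "- \<sigma>"] assms(1) by auto
  have "(\<Sum>k=1..N. (cmod (c (\<sigma> * int k)))\<^sup>2 / real k) - (\<Sum>k=1..N. (cmod (c (- \<sigma> * int k)))\<^sup>2 / real k)
      \<le> (L1_norm g)\<^sup>2"
    using fourier_coeff_signed_sum_le[OF assms(2), of N] assms(1)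
    by (auto simp: c_def diff_divide_distrib sum_subtractf abs_le_iff)
  with neg have pos: "(\<Sum>k=1..N. (cmod (c (\<sigma> * int k)))\<^sup>2 / real k) \<le> X + (L1_norm g)\<^sup>2"
    by linarith
  have "(\<Sum>k=1..N. (cmod (f (\<sigma> * int k) + c (\<sigma> * int k)))\<^sup>2 / real k) \<le>
      (\<Sum>k=1..N. 2 * ((cmod (f (\<sigma> * int k)))\<^sup>2 / real k) + 2 * ((cmod (c (\<sigma> * int k)))\<^sup>2 / real k))"
    by (intro sum_mono order_trans[OF divide_right_mono[OF norm_add_sq_le]]) (auto simp: add_divide_distrib)
  also have "\<dots> = 2 * (\<Sum>k=1..N. (cmod (f (\<sigma> * int k)))\<^sup>2 / real k) + 2 * (\<Sum>k=1..N. (cmod (c (\<sigma> * int k)))\<^sup>2 / real k)"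
    by (simp only: sum.distrib sum_distrib_left)
  also have "\<dots> \<le> 4 * X + 2 * (L1_norm g)\<^sup>2"
    using pos fX[OF assms(1)] by linarith
  finally show ?thesis
    by (simp add: c_def)
qed

lemma L1_norm_lincomb_le:
  assumes "f \<in> L1" "g \<in> L1"
  shows "L1_norm (\<lambda>x. a * f x + b * g x) \<le> cmod a * L1_norm f + cmod b * L1_norm g"
proof -
  have "L1_norm (\<lambda>x. a * f x + b * g x) \<le> (LINT x|circle. cmod a * cmod (f x) + cmod b * cmod (g x))"
    unfolding L1_norm_def
  proof (rule Bochner_Integration.integral_mono)
    show "cmod (a * f x + b * g x) \<le> cmod a * cmod (f x) + cmod b * cmod (g x)" for x
      using norm_triangle_ineq[of "a * f x" "b * g x"] by (simp add: norm_mult)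
  qed (use assms in \<open>auto simp: L1_def\<close>)
  also have "\<dots> = cmod a * L1_norm f + cmod b * L1_norm g"
    using assms by (simp add: L1_def L1_norm_def)
  finally show ?thesis .
qed

text \<open>
  With \<open>v = (-\<Delta>)^(1/4) u\<close>, the combination \<open>v - \<i> \<sigma> R v\<close> has coefficients
  \<open>(1 + \<sigma> sgn m) * fourier_coeff v m\<close>, so it only sees frequencies of sign \<open>\<sigma>\<close>.
\<close>

lemma fourier_coeff_sum_le:
  assumes f: "f1 \<in> H_minus_half" "f2 \<in> H_minus_half" and g: "g1 \<in> L1" "g2 \<in> L1"
    and u1: "quarter_laplacian u = (\<lambda>\<phi>. f1 \<phi> + dist_of g1 \<phi>)"
    and u2: "riesz_transform (quarter_laplacian u) = (\<lambda>\<phi>. f2 \<phi> + dist_of g2 \<phi>)"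
    and A: "finite A" "0 \<notin> A"
  shows "(\<Sum>m\<in>A. (cmod (fourier_coeff u m))\<^sup>2) \<le>
    4 * ((H_minus_half_norm f1 + L1_norm g1) + (H_minus_half_norm f2 + L1_norm g2))\<^sup>2"
proof -
  define S where "S = (H_minus_half_norm f1 + L1_norm g1) + (H_minus_half_norm f2 + L1_norm g2)"
  have nn: "0 \<le> H_minus_half_norm f" "0 \<le> L1_norm h" for f h
    by (auto simp: H_minus_half_norm_def L1_norm_def intro!: infsum_nonneg)
  have gi: "integrable circle g1" "integrable circle g2"
    using g by (auto simp: L1_def)
  have c1: "fourier_coeff f1 m + fourier_coeff (dist_of g1) m = sqrt \<bar>of_int m\<bar> * fourier_coeff u m" for m
    using arg_cong[OF u1, of "\<lambda>w. fourier_coeff w m"]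
    unfolding quarter_laplacian_def fourier_coeff_multiplier
    by (simp add: fourier_coeff_def add_divide_distrib)
  have c2: "fourier_coeff f2 m + fourier_coeff (dist_of g2) m =
      \<i> * of_int (sgn m) * (sqrt \<bar>of_int m\<bar> * fourier_coeff u m)" for m
    using arg_cong[OF u2, of "\<lambda>w. fourier_coeff w m"]
    unfolding riesz_transform_def quarter_laplacian_def fourier_coeff_multiplier
    by (simp add: fourier_coeff_def add_divide_distrib)
  have half: "(\<Sum>k=1..N. (cmod (fourier_coeff u (\<sigma> * int k)))\<^sup>2) \<le> 2 * S\<^sup>2" if \<sigma>: "\<sigma> = 1 \<or> \<sigma> = - 1" for \<sigma> N
  proof -
    \<comment> \<open>Chosen so that \<open>b\<close> times the Riesz multiplier
      \<open>\<i> * of_int (sgn m)\<close> is \<open>\<sigma> * sgn m\<close>.\<close>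
    define b where "b = - \<i> * of_int \<sigma>"
    have b1: "cmod b = 1"
      using \<sigma> by (auto simp: b_def)
    define f where "f = (\<lambda>m. fourier_coeff f1 m + b * fourier_coeff f2 m)"
    define h where "h = (\<lambda>x. 1 * g1 x + b * g2 x)"
    define X where "X = 2 * (H_minus_half_norm f1)\<^sup>2 + 2 * (H_minus_half_norm f2)\<^sup>2"
    have hL1: "h \<in> L1"
      using gi by (simp add: h_def L1_def)
    have fX: "(\<Sum>m\<in>A. (cmod (f m))\<^sup>2 / \<bar>of_int m\<bar>) \<le> X" if "finite A" "0 \<notin> A" for A
    proof -
      have "(cmod (f m))\<^sup>2 / \<bar>of_int m\<bar> \<le>
          2 * ((cmod (fourier_coeff f1 m))\<^sup>2 / \<bar>of_int m\<bar>) + 2 * ((cmod (fourier_coeff f2 m))\<^sup>2 / \<bar>of_int m\<bar>)" for m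
        using divide_right_mono[OF norm_add_sq_le[of "fourier_coeff f1 m" "b * fourier_coeff f2 m"], of "\<bar>of_int m\<bar>"] b1
        by (simp add: f_def norm_mult add_divide_distrib)
      then have "(\<Sum>m\<in>A. (cmod (f m))\<^sup>2 / \<bar>of_int m\<bar>) \<le>
          2 * (\<Sum>m\<in>A. (cmod (fourier_coeff f1 m))\<^sup>2 / \<bar>of_int m\<bar>) + 2 * (\<Sum>m\<in>A. (cmod (fourier_coeff f2 m))\<^sup>2 / \<bar>of_int m\<bar>)"
        unfolding sum_distrib_left sum.distrib[symmetric] by (rule sum_mono)
      then show ?thesis
        using H_minus_half_sum_le[OF assms(1) that] H_minus_half_sum_le[OF assms(2) that] unfolding X_def by linarith
    qed
    have fh: "f m + fourier_coeff (dist_of h) m = (1 + of_int (\<sigma> * sgn m)) * (sqrt \<bar>of_int m\<bar> * fourier_coeff u m)" for m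
    proof -
      have "f m + fourier_coeff (dist_of h) m =
          (fourier_coeff f1 m + fourier_coeff (dist_of g1) m) + b * (fourier_coeff f2 m + fourier_coeff (dist_of g2) m)"
        unfolding h_def f_def fourier_coeff_dist_of_lincomb[OF gi] by (simp add: algebra_simps)
      then show ?thesis
        unfolding c1 c2 b_def by (simp add: algebra_simps)
    qed
    have "(\<Sum>k=1..N. (cmod (f (\<sigma> * int k) + fourier_coeff (dist_of h) (\<sigma> * int k)))\<^sup>2 / real k)
        \<le> 4 * X + 2 * (L1_norm h)\<^sup>2"
      by (rule fourier_coeff_one_sided_sum_le[OF \<sigma> hL1 fX]) (use \<sigma> in \<open>auto simp: fh sgn_mult\<close>)
    \<comment> \<open>Here \<open>1 + \<sigma> * sgn m\<close> is 2, whence the 4, and the squared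
      \<open>sqrt k\<close> cancels the weight \<open>1 / k\<close>.\<close>
    moreover have "(cmod (f (\<sigma> * int k) + fourier_coeff (dist_of h) (\<sigma> * int k)))\<^sup>2 / real k =
        4 * (cmod (fourier_coeff u (\<sigma> * int k)))\<^sup>2" if "k \<in> {1..N}" for k
      using \<sigma> that unfolding fh by (auto simp: sgn_mult norm_mult power_mult_distrib abs_mult)
    ultimately have "4 * (\<Sum>k=1..N. (cmod (fourier_coeff u (\<sigma> * int k)))\<^sup>2) \<le> 4 * X + 2 * (L1_norm h)\<^sup>2"
      by (simp add: sum_distrib_left)
    moreover have "L1_norm h \<le> L1_norm g1 + L1_norm g2"
      using L1_norm_lincomb_le[OF g, of 1 b] b1 by (simp add: h_def)
    then have "(L1_norm h)\<^sup>2 \<le> (L1_norm g1 + L1_norm g2)\<^sup>2"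
      using nn by (intro power_mono) auto
    \<comment> \<open>After division by 4 each sign of frequency contributes \<open>2 * S^2\<close>,
      and both together \<open>4 * S^2\<close>.\<close>
    moreover have "4 * X + 2 * (L1_norm g1 + L1_norm g2)\<^sup>2 \<le> 8 * S\<^sup>2"
    proof -
      have *: "4 * (2 * p\<^sup>2 + 2 * q\<^sup>2) + 2 * w\<^sup>2 \<le> 8 * (p + q + w)\<^sup>2" if "0 \<le> p" "0 \<le> q" "0 \<le> w" for p q w :: real
        using that zero_le_power2[of w]
          mult_nonneg_nonneg[OF that(1,2)] mult_nonneg_nonneg[OF that(1,3)] mult_nonneg_nonneg[OF that(2,3)]
        by (simp add: power2_eq_square algebra_simps)
      have "S = H_minus_half_norm f1 + H_minus_half_norm f2 + (L1_norm g1 + L1_norm g2)"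
        by (simp add: S_def)
      then show ?thesis
        unfolding X_def using *[OF nn(1)[of f1] nn(1)[of f2] add_nonneg_nonneg[OF nn(2)[of g1] nn(2)[of g2]]]
        by (simp only:)
    qed
    ultimately show ?thesis by linarith
  qed
  obtain N where N: "A \<subseteq> {- int N..int N}"
  proof -
    obtain B where "\<And>m. m \<in> A \<Longrightarrow> \<bar>m\<bar> \<le> B"
      using finite_imageI[OF A(1), of abs] by (meson bdd_above_finite bdd_above.E imageI)
    then have "A \<subseteq> {- int (nat B)..int (nat B)}"
      by force
    then show ?thesis using that by blast
  qed
  have "(\<Sum>m\<in>A. (cmod (fourier_coeff u m))\<^sup>2) \<le> (\<Sum>m\<in>{- int N..int N} - {0}. (cmod (fourier_coeff u m))\<^sup>2)"
    using N A by (intro sum_mono2) auto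
  also have "\<dots> \<le> 4 * S\<^sup>2"
    using half[of 1 N] half[of "-1" N] unfolding sum_symmetric_int sum.distrib by simp
  finally show ?thesis
    by (simp add: S_def)
qed

section \<open>Infima over decompositions and the final theorem\<close>

text \<open>The decompositions of the two distributions vary independently, so each infimum is taken
  in turn with the other variable fixed.\<close>

lemma add_Inf_ge:
  fixes P Q :: "real set"
  assumes "P \<noteq> {}" "Q \<noteq> {}" "\<And>p q. p \<in> P \<Longrightarrow> q \<in> Q \<Longrightarrow> c \<le> p + q"
  shows "c \<le> Inf P + Inf Q"
proof -
  have "c - p \<le> Inf Q" if "p \<in> P" for p
  proof (rule cInf_greatest[OF assms(2)])
    show "c - p \<le> q" if "q \<in> Q" for q
      using assms(3)[OF \<open>p \<in> P\<close> that] by simp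
  qed
  then have "c - Inf Q \<le> p" if "p \<in> P" for p
    using that by fastforce
  then have "c - Inf Q \<le> Inf P"
    by (rule cInf_greatest[OF assms(1)])
  then show ?thesis by simp
qed

theorem theorem3:
  "\<exists>C::real. C > 0 \<and>
     (\<forall>u :: (real \<Rightarrow> complex) \<Rightarrow> complex.
        distribution u \<longrightarrow>
        quarter_laplacian u \<in> H_plus_L1 \<longrightarrow>
        riesz_transform (quarter_laplacian u) \<in> H_plus_L1 \<longrightarrow>
        (\<exists>v \<in> L2_star.
           (\<lambda>\<phi>. u \<phi> - dist_of (\<lambda>_. dist_mean u) \<phi>) = dist_of v \<and>
           L2_norm v \<le> C * (H_plus_L1_norm (quarter_laplacian u)
                            + H_plus_L1_norm (riesz_transform (quarter_laplacian u)))))"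
proof (intro exI[of _ 6] conjI allI impI)
  fix u :: "(real \<Rightarrow> complex) \<Rightarrow> complex"
  assume u: "distribution u"
    and u1: "quarter_laplacian u \<in> H_plus_L1"
    and u2: "riesz_transform (quarter_laplacian u) \<in> H_plus_L1"
  define \<alpha> where "\<alpha> = H_plus_L1_norm (quarter_laplacian u) + H_plus_L1_norm (riesz_transform (quarter_laplacian u))"
  \<comment> \<open>The left side does not depend on the decompositions; the factor 1/2 is due to
    the 4 in \<open>fourier_coeff_sum_le\<close>.\<close>
  have bound: "sqrt (\<Sum>m\<in>A. (cmod (fourier_coeff u m))\<^sup>2) / 2 \<le> \<alpha>" if A: "finite A" "0 \<notin> A" for A
    unfolding \<alpha>_def H_plus_L1_norm_def
  proof (rule add_Inf_ge, goal_cases)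
    case 1
    then show ?case using u1 by (auto simp: H_plus_L1_def)
  next
    case 2
    then show ?case using u2 by (auto simp: H_plus_L1_def)
  next
    case (3 p q)
    then obtain f1 g1 f2 g2 where fg: "f1 \<in> H_minus_half" "f2 \<in> H_minus_half" "g1 \<in> L1" "g2 \<in> L1"
      "quarter_laplacian u = (\<lambda>\<phi>. f1 \<phi> + dist_of g1 \<phi>)"
      "riesz_transform (quarter_laplacian u) = (\<lambda>\<phi>. f2 \<phi> + dist_of g2 \<phi>)"
      and pq: "p = H_minus_half_norm f1 + L1_norm g1" "q = H_minus_half_norm f2 + L1_norm g2"
      by auto
    have "0 \<le> p + q"
      unfolding pq by (auto simp: H_minus_half_norm_def L1_norm_def intro!: infsum_nonneg add_nonneg_nonneg)
    moreover have "(\<Sum>m\<in>A. (cmod (fourier_coeff u m))\<^sup>2) \<le> 4 * (p + q)\<^sup>2"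
      unfolding pq by (rule fourier_coeff_sum_le[OF fg A])
    then have "(\<Sum>m\<in>A. (cmod (fourier_coeff u m))\<^sup>2) \<le> (2 * (p + q))\<^sup>2"
      by (simp only: power_mult_distrib) simp
    ultimately have "sqrt (\<Sum>m\<in>A. (cmod (fourier_coeff u m))\<^sup>2) \<le> 2 * (p + q)"
      by (intro real_le_lsqrt) (auto intro: sum_nonneg)
    then show ?case by simp
  qed
  have \<alpha>0: "0 \<le> \<alpha>"
    using bound[of "{}"] by simp
  \<comment> \<open>The multiplier \<open>|m|^(1/2)\<close> vanishes at 0 and gives no control
    there; setting this coefficient to 0 amounts to subtracting the mean.\<close>
  define a where "a = (\<lambda>m. if m = 0 then 0 else fourier_coeff u m)"
  have "(\<Sum>m\<in>A. (cmod (a m))\<^sup>2) \<le> 4 * \<alpha>\<^sup>2" if "finite A" for A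
  proof -
    have "(\<Sum>m\<in>A. (cmod (a m))\<^sup>2) = (\<Sum>m\<in>A - {0}. (cmod (fourier_coeff u m))\<^sup>2)"
      using that by (intro sum.mono_neutral_cong_right) (auto simp: a_def)
    moreover have "sqrt (\<Sum>m\<in>A - {0}. (cmod (fourier_coeff u m))\<^sup>2) \<le> 2 * \<alpha>"
      using bound[of "A - {0}"] that by simp
    then have "(\<Sum>m\<in>A - {0}. (cmod (fourier_coeff u m))\<^sup>2) \<le> (2 * \<alpha>)\<^sup>2"
      by (rule sqrt_le_D)
    ultimately show ?thesis
      by (simp add: power_mult_distrib)
  qed
  then obtain v where v: "v \<in> L2" "\<And>m. fourier_coeff (dist_of v) m = a m"
    "(LINT x|circle. (cmod (v x))\<^sup>2) \<le> 2*pi * (4 * \<alpha>\<^sup>2)"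
    using riesz_fischer by metis
  show "\<exists>v \<in> L2_star. (\<lambda>\<phi>. u \<phi> - dist_of (\<lambda>_. dist_mean u) \<phi>) = dist_of v \<and>
      L2_norm v \<le> 6 * (H_plus_L1_norm (quarter_laplacian u) + H_plus_L1_norm (riesz_transform (quarter_laplacian u)))"
  proof (intro bexI[of _ v] conjI ext)
    show "v \<in> L2_star"
      using v(1) v(2)[of 0] by (simp add: L2_star_def a_def fourier_coeff_dist_of)
    \<comment> \<open>The constant 6 of the theorem: \<open>8 * pi < 32 \<le> 6^2\<close>.\<close>
    have "2*pi * (4 * \<alpha>\<^sup>2) \<le> (6 * \<alpha>)\<^sup>2"
    proof -
      have "2*pi * (4 * \<alpha>\<^sup>2) \<le> 2*4 * (4 * \<alpha>\<^sup>2)"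
        using pi_less_4 by (intro mult_right_mono) auto
      also have "\<dots> \<le> (6 * \<alpha>)\<^sup>2"
        by (simp add: power_mult_distrib)
      finally show ?thesis .
    qed
    then have "(LINT x|circle. (cmod (v x))\<^sup>2) \<le> (6 * \<alpha>)\<^sup>2"
      using v(3) by linarith
    then show "L2_norm v \<le> 6 * (H_plus_L1_norm (quarter_laplacian u) + H_plus_L1_norm (riesz_transform (quarter_laplacian u)))"
      unfolding L2_norm_def \<alpha>_def[symmetric] using \<alpha>0 by (intro real_le_lsqrt) auto
  next
    fix \<phi>
    show "u \<phi> - dist_of (\<lambda>_. dist_mean u) \<phi> = dist_of v \<phi>"
    proof (cases "test_fun \<phi>")
      \<comment> \<open>Off the test functions both sides are 0 by convention.\<close>
      case False
      then show ?thesis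
        using u by (simp add: distribution_def dist_of_def)
    next
      case True
      let ?e = "\<lambda>_::real. dist_mean u"
      \<comment> \<open>Agreement of the Fourier coefficients is agreement on the modes, and
        \<open>distribution_LIMSEQ\<close> extends it to \<open>\<phi>\<close> by uniqueness of
        limits.\<close>
      have "u (mode m) - dist_of ?e (mode m) = dist_of v (mode m)" for m
      proof -
        have "fourier_coeff (dist_of ?e) (- m) = (if m = 0 then dist_mean u else 0)"
          using fourier_coeff_trig[of "{0}" "\<lambda>_. dist_mean u" "- m"] by simp
        then have "fourier_coeff u (- m) - fourier_coeff (dist_of ?e) (- m) = fourier_coeff (dist_of v) (- m)"
          by (auto simp: v(2) a_def dist_mean_def)
        then show ?thesis
          by (simp add: fourier_coeff_mode diff_divide_distrib[symmetric])
      qed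
      then have sums: "fourier_coeff (dist_of \<phi>) m * u (mode m) - fourier_coeff (dist_of \<phi>) m * dist_of ?e (mode m) =
          fourier_coeff (dist_of \<phi>) m * dist_of v (mode m)" for m
        by (simp only: right_diff_distrib[symmetric])
      have "(\<lambda>N. \<Sum>m\<in>{- int N..int N}. fourier_coeff (dist_of \<phi>) m * dist_of v (mode m))
          \<longlonglongrightarrow> u \<phi> - dist_of ?e \<phi>"
        unfolding sums[symmetric] sum_subtractf
        by (intro tendsto_diff distribution_LIMSEQ u distribution_dist_of True) simp
      moreover have "(\<lambda>N. \<Sum>m\<in>{- int N..int N}. fourier_coeff (dist_of \<phi>) m * dist_of v (mode m))
          \<longlonglongrightarrow> dist_of v \<phi>"
        by (intro distribution_LIMSEQ distribution_dist_of L2_integrable v True)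
      ultimately show ?thesis
        by (rule LIMSEQ_unique)
    qed
  qed
qed simp

end
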